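(* Let $2 < p < q$, $f \in \mathrm{L}^2 (\mathbb{R}^d ; \mathbb{C}^m) \cap \mathrm{L}^p (\mathbb{R}^d ; \mathbb{C}^m)$, and let $T$ be an operator (not necessarily linear) such that $T(f)$ is defined and contained in $\mathrm{L}^2 (\mathbb{R}^d ; \mathbb{C}^n)$. Suppose that there exist constants $\alpha_2 > \alpha_1 > 1$ and $\mathcal{C} > 0$ such that for all $\iota > 0$, all $Q = Q(x_0 , r)$ with $r > 0$ and $x_0 \in \mathbb{R}^d$, and all parents $Q^*$ of $Q$ the estimate $$\lvert \{ x \in Q : M_{2 Q^*} (\lvert T(f) \rvert^2) (x) > \iota \} \rvert \leq \frac{\mathcal{C}}{\iota} \int_{2 \alpha_2 Q^*} \lvert f \rvert^2 \, dx + \frac{\mathcal{C} \lvert Q \rvert}{\iota^{q / 2}} \bigg\{ \bigg( \frac{1}{\lvert Q \rvert} \int_{2 \alpha_2 Q^*} \lvert T(f) \rvert^2 \, dx \bigg)^{\frac{1}{2}} + \sup_{Q^{\prime} \supset 2 Q^*} \bigg( \frac{1}{\lvert Q^{\prime} \rvert} \int_{Q^{\prime}} \lvert f \rvert^2 \, dx \bigg)^{\frac{1}{2}} \bigg\}^q$$ holds. Here the supremum runs over all cubes $Q^{\prime}$ containing $2 Q^*$. Then there exists a constant $C > 0$ depending on $d$, $p$, $q$, $\alpha_1$, $\alpha_2$, and $\mathcal{C}$ such that $$\| T(f) \|_{\mathrm{L}^p (\mathbb{R}^d ; \mathbb{C}^n)} \leq C \| f \|_{\mathrm{L}^p (\mathbb{R}^d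 ; \mathbb{C}^m)}.$$
   Context: Here $m,n,d$ are positive integers. Cubes are non-degenerate open cubes in $\mathbb{R}^d$ with sides parallel to the coordinate axes; $Q(x_0,r)$ is the cube with center $x_0$ and diameter $\operatorname{diam}(Q(x_0,r)) = r$. For $\alpha>0$ and $Q = Q(x_0,r)$, $\alpha Q := Q(x_0,\alpha r)$. A cube $Q^*$ is a parent of a cube $Q$ if $Q$ arises from $Q^*$ by bisecting its sides (i.e. $Q$ is one of the $2^d$ subcubes obtained by bisecting each side of $Q^*$). $|\cdot|$ of a set denotes Lebesgue measure. The localized maximal operator is $$M_{2 Q^*} g (x) := \sup_{R \ni x,\ R \subset 2 Q^*}\frac{1}{\lvert R \rvert} \int_R \lvert g \rvert \, dy \qquad (x \in 2 Q^* ),$$ where the supremum is over cubes $R$ in $\mathbb{R}^d$. *)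

theory Defs
  imports "HOL-Analysis.Analysis"
begin

(* r is the diameter, so the side length is r / sqrt d. *)
definition cube :: "real ^ 'd \<Rightarrow> real \<Rightarrow> (real ^ 'd) set" where
  "cube x r = box (x - (\<chi> i. r / (2 * sqrt (real CARD('d)))))
                  (x + (\<chi> i. r / (2 * sqrt (real CARD('d)))))"

lemma mem_cube:
  fixes x y :: "real ^ 'd"
  shows "y \<in> cube x r \<longleftrightarrow> (\<forall>i. \<bar>y $ i - x $ i\<bar> < r / (2 * sqrt (real CARD('d))))"
proof -
  have "(a - h < b \<and> b < a + h) \<longleftrightarrow> \<bar>b - a\<bar> < h" for a b h :: real
    by auto
  then show ?thesis
    by (simp add: cube_def mem_box_cart)
qed

lemma diameter_cube:
  fixes x :: "real ^ 'd"
  assumes "r > 0"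
  shows "diameter (cube x r) = r"
proof -
  define h where "h = r / (2 * sqrt (real CARD('d)))"
  define v :: "real ^ 'd" where "v = (\<chi> i. h)"
  have h: "h > 0" using assms by (simp add: h_def)
  have ne: "box (x - v) (x + v) \<noteq> {}"
    using h by (simp add: interval_ne_empty_cart v_def)
  have "diameter (cube x r) = diameter (closure (box (x - v) (x + v)))"
    by (simp add: cube_def v_def h_def diameter_closure)
  also have "\<dots> = diameter (cbox (x - v) (x + v))"
    using closure_box[OF ne] by simp
  also have "\<dots> = dist (x - v) (x + v)"
    using h by (intro diameter_cbox) (auto simp: Basis_vec_def inner_axis v_def)
  also have "\<dots> = norm (2 *\<^sub>R v)"
    by (simp add: dist_norm norm_minus_commute scaleR_2)
  also have "\<dots> = 2 * (h * sqrt (real CARD('d)))"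
    using h by (simp add: v_def norm_vec_def L2_set_def real_sqrt_mult)
  also have "\<dots> = r"
    by (simp add: h_def)
  finally show ?thesis .
qed

definition cubes :: "(real ^ 'd) set set" where
  "cubes = {cube x r | x r. r > 0}"

(* The 2^d open subcubes of cube x r obtained by bisecting its sides; S is the set of
   coordinates in which the lower half is taken. *)
definition children :: "real ^ 'd \<Rightarrow> real \<Rightarrow> (real ^ 'd) set set" where
  "children x r =
     {{y \<in> cube x r. \<forall>i. if i \<in> S then y $ i < x $ i else x $ i < y $ i} | S. True}"

definition is_parent :: "real ^ 'd \<Rightarrow> real \<Rightarrow> real ^ 'd \<Rightarrow> real \<Rightarrow> bool" where
  "is_parent x' r' x r \<longleftrightarrow> r' > 0 \<and> r > 0 \<and> cube x r \<in> children x' r'"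

definition local_maximal :: "(real ^ 'd) set \<Rightarrow> (real ^ 'd \<Rightarrow> real) \<Rightarrow> real ^ 'd \<Rightarrow> ennreal" where
  "local_maximal A g x =
     (SUP R \<in> {R \<in> cubes. x \<in> R \<and> R \<subseteq> A}.
        (\<integral>\<^sup>+ y \<in> R. ennreal \<bar>g y\<bar> \<partial>lebesgue) / emeasure lebesgue R)"

(* A vector of C^k is a function in {..<k} ->E UNIV, the points of the product space below.
   The dimension is a number and not a type, so that it can be quantified inside a formula. *)
definition cnorm :: "nat \<Rightarrow> (nat \<Rightarrow> complex) \<Rightarrow> real" where
  "cnorm k v = L2_set (\<lambda>i. cmod (v i)) {..<k}"

definition Lp_space :: "nat \<Rightarrow> real \<Rightarrow> (real ^ 'd \<Rightarrow> nat \<Rightarrow> complex) set" where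
  "Lp_space k p =
     {f \<in> lebesgue \<rightarrow>\<^sub>M (\<Pi>\<^sub>M i\<in>{..<k}. borel).
        integrable lebesgue (\<lambda>x. cnorm k (f x) powr p)}"

definition Lp_norm :: "nat \<Rightarrow> real \<Rightarrow> (real ^ 'd \<Rightarrow> nat \<Rightarrow> complex) \<Rightarrow> real" where
  "Lp_norm k p f = (LINT x|lebesgue. cnorm k (f x) powr p) powr (1 / p)"

end

theory Submission
  imports Defs
begin

text \<open>
  Only the functions \<open>F = |f|^2\<close> and \<open>G = |T(f)|^2\<close> matter: both are nonnegative and integrable, and
  with \<open>s = p/2 > 1\<close> the claim is \<open>\<integral> G^s \<le> C \<integral> F^s\<close>. The proof is a good-lambda argument for the
  uncentred maximal operator \<open>M\<close> over cubes.

  Suppose that \<open>M F \<le> \<gamma> l\<close> at the centre of a cube \<open>Q\<close> and \<open>M G \<le> l\<close> somewhere in \<open>Q\<close>. For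
  \<open>A \<ge> 3^d\<close>, the points of \<open>Q\<close> with \<open>M G > A l\<close> have \<open>M_{2 Q*} G > A l\<close>: a cube that meets \<open>Q\<close> and
  leaves \<open>2 Q*\<close> is so large that its dilate by 3 swallows \<open>Q\<close>; the dilate
  then contains a point with \<open>M G \<le> l\<close>, so the mean of \<open>G\<close> over it is at most \<open>l\<close>. The hypothesis at level \<open>A l\<close> then bounds the share of \<open>Q\<close> they fill by
  a constant times \<open>\<gamma>/A + A^(-q/2)\<close>, since every mean on its right-hand side is over a set that
  contains both points (\<open>cube_subset_superlevel\<close>). Read backwards: if \<open>M G > A l\<close> on more than a
  share \<open>\<delta>\<close> of \<open>Q\<close>, then \<open>M G > l\<close> on all of \<open>Q\<close>, unless \<open>M F > \<gamma> l\<close> at its centre. Centring at each point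
  with \<open>M G > A l\<close> a nearly largest cube of density more than \<open>\<delta>\<close> and applying Vitali's covering
  lemma gives
    \<open>|{M G > A l}| \<le> \<delta> k^d |{M G > l}| + |{M F > \<gamma> l}|\<close>
  with the Vitali factor \<open>k\<close> (\<open>good_lambda\<close>).

  Multiplied by \<open>(A l)^s\<close> and summed over the levels \<open>l, A l, A^2 l, \<dots>\<close>, this gives the result as soon
  as \<open>A^s \<delta> k^d \<le> 1/2\<close>, because then the first term on the right is absorbed
  (\<open>strong_type_truncated\<close>); the sum over \<open>{M F > \<gamma> l}\<close> is the Hardy-Littlewood maximal theorem for
  \<open>F\<close>. So \<open>\<delta>\<close> must be of order \<open>A^(-s)\<close>. The hypothesis provides \<open>A^(-q/2)\<close>, which is smaller for large
  \<open>A\<close> because \<open>p < q\<close>; accordingly \<open>A\<close> is chosen large first and \<open>\<gamma>\<close> small afterwards. The initial term of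
  the sum is controlled by the weak type bound for the integrable function \<open>G\<close> and vanishes
  as \<open>l\<close> tends to 0 because \<open>s > 1\<close>. Finally, \<open>G \<le> M G\<close> almost everywhere by Lebesgue's differentiation
  theorem (\<open>AE_le_off_superlevel\<close>).
\<close>

section \<open>Cubes and Vitali's covering lemma\<close>

lemma emeasure_cube:
  fixes x :: "real ^ 'd"
  assumes "0 < r"
  shows "emeasure lebesgue (cube x r) = ennreal ((r / sqrt (real CARD('d))) ^ CARD('d))"
proof -
  define h where "h = r / (2 * sqrt (real CARD('d)))"
  have h: "0 < h" using assms by (simp add: h_def)
  have "emeasure lebesgue (cube x r) = emeasure lborel (cube x r)"
    by (simp add: cube_def)
  also have "\<dots> = ennreal (\<Prod>b\<in>Basis. ((x + (\<chi> i. h)) - (x - (\<chi> i. h))) \<bullet> b)"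
    unfolding cube_def h_def[symmetric] using h
    by (intro emeasure_lborel_box) (auto simp: Basis_vec_def inner_axis)
  also have "(\<Prod>b\<in>(Basis :: (real ^ 'd) set). ((x + (\<chi> i. h)) - (x - (\<chi> i. h))) \<bullet> b)
      = (\<Prod>b\<in>(Basis :: (real ^ 'd) set). 2 * h)"
    by (intro prod.cong refl) (auto simp: Basis_vec_def inner_axis)
  also have "\<dots> = (2 * h) ^ CARD('d)" by simp
  also have "2 * h = r / sqrt (real CARD('d))" by (simp add: h_def)
  finally show ?thesis .
qed

lemma measure_cube:
  fixes x :: "real ^ 'd"
  assumes "0 < r"
  shows "measure lebesgue (cube x r) = (r / sqrt (real CARD('d))) ^ CARD('d)"
  using assms by (simp add: measure_def emeasure_cube)

lemma measure_cube_pos: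
  fixes x :: "real ^ 'd"
  assumes "0 < r"
  shows "0 < measure lebesgue (cube x r)"
  using assms by (simp add: measure_cube)

lemma emeasure_cube_dilate:
  fixes x y :: "real ^ 'd"
  assumes "0 < r" "0 < a"
  shows "emeasure lebesgue (cube y (a * r)) = ennreal (a ^ CARD('d)) * emeasure lebesgue (cube x r)"
  using assms
  by (simp add: emeasure_cube ennreal_mult[symmetric] power_mult_distrib[symmetric])

lemma measure_cube_dilate:
  fixes x y :: "real ^ 'd"
  assumes "0 < r" "0 < a"
  shows "measure lebesgue (cube y (a * r)) = a ^ CARD('d) * measure lebesgue (cube x r)"
  using assms by (simp add: measure_cube power_mult_distrib[symmetric])

lemma open_cube: "open (cube x r)"
  by (simp add: cube_def open_box)

lemma sets_open: "open S \<Longrightarrow> S \<in> sets lebesgue" for S :: "'a::euclidean_space set"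
  by (simp add: borel_open sets_completionI_sets)

lemma sets_cube [measurable]: "cube x r \<in> sets lebesgue"
  by (rule sets_open[OF open_cube])

lemma emeasure_cube_finite: "emeasure lebesgue (cube x r) < \<infinity>"
  using emeasure_bounded_finite[OF bounded_box] by (simp add: cube_def)

lemma center_in_cube: "0 < r \<Longrightarrow> x \<in> cube x r"
  by (simp add: mem_cube)

lemma cube_subset_cball:
  fixes x :: "real ^ 'd"
  shows "cube x r \<subseteq> cball x (r / 2)"
proof
  fix y assume y: "y \<in> cube x r"
  have "norm (y - x) \<le> sqrt (\<Sum>i\<in>(UNIV :: 'd set). (r / (2 * sqrt (real CARD('d))))\<^sup>2)"
    unfolding norm_vec_def L2_set_def
    by (intro real_sqrt_le_mono sum_mono power_mono)
       (use y in \<open>auto simp: mem_cube real_norm_def intro!: less_imp_le\<close>)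
  also have "\<dots> = \<bar>r\<bar> / 2"
    by (simp add: power_divide power_mult_distrib real_sqrt_divide)
  also have "\<bar>r\<bar> = r"
  proof -
    have "0 < r / (2 * sqrt (real CARD('d)))"
      using y abs_ge_zero[of "y $ undefined - x $ undefined"] unfolding mem_cube
      by (meson le_less_trans)
    then show ?thesis by (simp add: zero_less_divide_iff)
  qed
  finally show "y \<in> cball x (r / 2)"
    by (simp add: dist_norm norm_minus_commute)
qed

lemma cball_subset_cube:
  fixes x :: "real ^ 'd"
  assumes "\<rho> * (2 * sqrt (real CARD('d))) < r"
  shows "cball x \<rho> \<subseteq> cube x r"
proof
  fix y assume y: "y \<in> cball x \<rho>"
  have "\<bar>y $ i - x $ i\<bar> \<le> \<rho>" for i
    using component_le_norm_cart[of "y - x" i] y by (simp add: dist_norm norm_minus_commute)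
  moreover have "\<rho> < r / (2 * sqrt (real CARD('d)))"
    using assms by (simp add: pos_less_divide_eq)
  ultimately show "y \<in> cube x r" unfolding mem_cube by (meson le_less_trans)
qed

text \<open>
  Vitali's lemma for balls dilates by 5. A cube of diameter \<open>r\<close> lies in a ball of radius \<open>r/2\<close>, and
  the ball of radius \<open>5r/2\<close> lies in the open cube of half side \<open>3r\<close>, whose diameter is \<open>6 \<surd>d r\<close>.
\<close>

definition vitali_factor :: "'d::finite itself \<Rightarrow> real" where
  "vitali_factor _ = 6 * sqrt (real CARD('d))"

lemma vitali_factor_ge: "6 \<le> vitali_factor TYPE('d::finite)"
  by (simp add: vitali_factor_def)

lemma vitali_cubes:
  fixes I :: "((real ^ 'd) \<times> real) set"
  assumes "\<And>c r. (c, r) \<in> I \<Longrightarrow> 0 < r \<and> r \<le> B"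
  obtains J where "countable J" "J \<subseteq> I" "disjoint_family_on (\<lambda>(c, r). cube c r) J"
    "(\<Union>(c, r)\<in>I. cube c r) \<subseteq> (\<Union>(c, r)\<in>J. cube c (vitali_factor TYPE('d) * r))"
proof -
  obtain J where J: "countable J" "J \<subseteq> I"
    "pairwise (\<lambda>i j. disjnt (cball (fst i) (snd i / 2)) (cball (fst j) (snd j / 2))) J"
    "(\<Union>i\<in>I. cball (fst i) (snd i / 2)) \<subseteq> (\<Union>i\<in>J. cball (fst i) (5 * (snd i / 2)))"
  proof (rule Vitali_covering_lemma_cballs[where S = "\<Union>i\<in>I. cball (fst i) (snd i / 2)" and K = I
        and a = fst and r = "\<lambda>i. snd i / 2" and B = "B / 2"])
    show "0 < snd i / 2 \<and> snd i / 2 \<le> B / 2" if "i \<in> I" for i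
      using assms[of "fst i" "snd i"] that by simp
  qed auto
  show thesis
  proof (rule that[OF J(1,2)])
    show "disjoint_family_on (\<lambda>(c, r). cube c r) J"
      using J(3) cube_subset_cball unfolding pairwise_def disjoint_family_on_def disjnt_def
      by fastforce
    have "(\<Union>(c, r)\<in>I. cube c r) \<subseteq> (\<Union>i\<in>I. cball (fst i) (snd i / 2))"
      using cube_subset_cball by fastforce
    also have "\<dots> \<subseteq> (\<Union>i\<in>J. cball (fst i) (5 * (snd i / 2)))" by (rule J(4))
    also have "\<dots> \<subseteq> (\<Union>(c, r)\<in>J. cube c (vitali_factor TYPE('d) * r))"
    proof (clarify)
      fix x c r assume "(c, r) \<in> J" and x: "x \<in> cball (fst (c, r)) (5 * (snd (c, r) / 2))"
      then have "0 < r" using assms J(2) by blast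
      then have "cball c (5 * (r / 2)) \<subseteq> cube c (vitali_factor TYPE('d) * r)"
        by (intro cball_subset_cube) (simp add: vitali_factor_def)
      with x \<open>(c, r) \<in> J\<close> show "x \<in> (\<Union>(c, r)\<in>J. cube c (vitali_factor TYPE('d) * r))"
        by (intro UN_I[of "(c, r)"]) auto
    qed
    finally show "(\<Union>(c, r)\<in>I. cube c r) \<subseteq> (\<Union>(c, r)\<in>J. cube c (vitali_factor TYPE('d) * r))" .
  qed
qed

text \<open>
  The common core of the two covering arguments below. With \<open>E\<close> the whole space it yields the weak
  type bound; with \<open>H = 1\<close> it says that a set which is sparse in the dilates of cubes
  lying in \<open>U\<close> is small compared with \<open>U\<close>. The bound is assumed for single cubes only; it adds up
  because the cubes that Vitali's lemma selects are disjoint and their dilates still cover.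
\<close>

lemma emeasure_cubes_le_of_dilates:
  fixes I :: "((real ^ 'd) \<times> real) set" and H :: "real ^ 'd \<Rightarrow> ennreal"
  assumes I: "\<And>c r. (c, r) \<in> I \<Longrightarrow> 0 < r \<and> r \<le> B"
    and E [measurable]: "E \<in> sets lebesgue" and H [measurable]: "H \<in> borel_measurable lebesgue"
    and U [measurable]: "U \<in> sets lebesgue"
    and sub: "\<And>c r. (c, r) \<in> I \<Longrightarrow> cube c r \<subseteq> U"
    and bd: "\<And>c r. (c, r) \<in> I \<Longrightarrow> emeasure lebesgue (E \<inter> cube c (vitali_factor TYPE('d) * r))
               \<le> b * (\<integral>\<^sup>+y\<in>cube c r. H y \<partial>lebesgue)"
  shows "emeasure lebesgue (E \<inter> (\<Union>(c, r)\<in>I. cube c r)) \<le> b * (\<integral>\<^sup>+y\<in>U. H y \<partial>lebesgue)"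
proof -
  obtain J where J: "countable J" "J \<subseteq> I" "disjoint_family_on (\<lambda>(c, r). cube c r) J"
    "(\<Union>(c, r)\<in>I. cube c r) \<subseteq> (\<Union>(c, r)\<in>J. cube c (vitali_factor TYPE('d) * r))"
    by (rule vitali_cubes[of I B]) (use I in auto)
  define V where "V = (\<lambda>(c :: real ^ 'd, r). E \<inter> cube c (vitali_factor TYPE('d) * r))"
  define Q where "Q = (\<lambda>(c :: real ^ 'd, r). cube c r)"
  have V [measurable]: "V i \<in> sets lebesgue" for i by (simp add: V_def split_beta)
  have Q [measurable]: "Q i \<in> sets lebesgue" for i by (simp add: Q_def split_beta)
  have VJ: "(\<Union>i\<in>J. V i) \<in> sets lebesgue" using J(1) by (intro sets.countable_UN'') auto
  have "emeasure lebesgue (E \<inter> (\<Union>(c, r)\<in>I. cube c r)) \<le> emeasure lebesgue (\<Union>i\<in>J. V i)"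
    using J(4) VJ by (intro emeasure_mono) (auto simp: V_def)
  also have "\<dots> = (\<integral>\<^sup>+x. indicator (\<Union>i\<in>J. V i) x \<partial>lebesgue)"
    using VJ by simp
  also have "\<dots> \<le> (\<integral>\<^sup>+x. (\<integral>\<^sup>+i. indicator (V i) x \<partial>count_space J) \<partial>lebesgue)"
  proof (intro nn_integral_mono)
    fix x
    show "indicator (\<Union>i\<in>J. V i) x \<le> (\<integral>\<^sup>+i. indicator (V i) x \<partial>count_space J)"
    proof (cases "x \<in> (\<Union>i\<in>J. V i)")
      case True
      then obtain i where i: "i \<in> J" "x \<in> V i" by blast
      then show ?thesis
        using nn_integral_ge_point[of i J "\<lambda>i. indicator (V i) x"] True by simp
    qed simp
  qed
  also have "\<dots> = (\<integral>\<^sup>+i. (\<integral>\<^sup>+x. indicator (V i) x \<partial>lebesgue) \<partial>count_space J)"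
    using J(1) by (intro nn_integral_count_space_nn_integral) auto
  also have "\<dots> = (\<integral>\<^sup>+i. emeasure lebesgue (V i) \<partial>count_space J)"
    by simp
  also have "\<dots> \<le> (\<integral>\<^sup>+i. b * (\<integral>\<^sup>+y\<in>Q i. H y \<partial>lebesgue) \<partial>count_space J)"
    using J(2) bd by (intro nn_integral_mono) (auto simp: V_def Q_def)
  also have "\<dots> = b * (\<integral>\<^sup>+i. (\<integral>\<^sup>+y\<in>Q i. H y \<partial>lebesgue) \<partial>count_space J)"
    by (rule nn_integral_cmult) simp
  also have "(\<integral>\<^sup>+i. (\<integral>\<^sup>+y\<in>Q i. H y \<partial>lebesgue) \<partial>count_space J)
      = (\<integral>\<^sup>+i. emeasure (density lebesgue H) (Q i) \<partial>count_space J)"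
    by (simp add: emeasure_density)
  also have "\<dots> = emeasure (density lebesgue H) (\<Union>i\<in>J. Q i)"
    by (rule emeasure_UN_countable[symmetric]) (use J in \<open>auto simp: Q_def\<close>)
  also have "\<dots> \<le> emeasure (density lebesgue H) U"
    using sub J(2) by (intro emeasure_mono) (auto simp: Q_def)
  also have "\<dots> = (\<integral>\<^sup>+y\<in>U. H y \<partial>lebesgue)"
    by (simp add: emeasure_density)
  finally show ?thesis by (simp add: mult_left_mono)
qed

section \<open>Superlevel sets of the maximal function\<close>

text \<open>
  This is \<open>{x. M H x > t}\<close> for the uncentred maximal operator \<open>M\<close>, written as the union of the cubes
  on which the mean of \<open>H\<close> exceeds \<open>t\<close>. In this form it is visibly open and no division in
  \<open>ennreal\<close> occurs.
\<close>

definition superlevel :: "(real ^ 'd \<Rightarrow> ennreal) \<Rightarrow> real \<Rightarrow> (real ^ 'd) set" where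
  "superlevel H t =
     (\<Union>(c, r)\<in>{(c, r). 0 < r \<and> ennreal t * emeasure lebesgue (cube c r) < (\<integral>\<^sup>+y\<in>cube c r. H y \<partial>lebesgue)}.
        cube c r)"

lemma mem_superlevel:
  "x \<in> superlevel H t \<longleftrightarrow>
     (\<exists>c r. 0 < r \<and> x \<in> cube c r \<and>
        ennreal t * emeasure lebesgue (cube c r) < (\<integral>\<^sup>+y\<in>cube c r. H y \<partial>lebesgue))"
  by (auto simp: superlevel_def)

lemma superlevelI:
  "0 < r \<Longrightarrow> x \<in> cube c r \<Longrightarrow>
   ennreal t * emeasure lebesgue (cube c r) < (\<integral>\<^sup>+y\<in>cube c r. H y \<partial>lebesgue) \<Longrightarrow> x \<in> superlevel H t"
  by (auto simp: mem_superlevel)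

lemma average_le_off_superlevel:
  "x \<notin> superlevel H t \<Longrightarrow> 0 < r \<Longrightarrow> x \<in> cube c r \<Longrightarrow>
   (\<integral>\<^sup>+y\<in>cube c r. H y \<partial>lebesgue) \<le> ennreal t * emeasure lebesgue (cube c r)"
  unfolding mem_superlevel by (meson not_le)

lemma open_superlevel: "open (superlevel H t)"
  by (auto simp: superlevel_def intro!: open_UN open_cube)

lemma sets_superlevel [measurable]: "superlevel H t \<in> sets lebesgue"
  by (rule sets_open[OF open_superlevel])

text \<open>
  Vitali's lemma needs bounded diameters; the measure of a cube grows at least linearly in its
  diameter once the side is at least 1.
\<close>

lemma cube_diam_bounded:
  fixes H :: "real ^ 'd \<Rightarrow> ennreal"
  assumes fin: "a < \<infinity>" and t: "0 < t"
  shows "\<exists>B. \<forall>(c :: real ^ 'd) r. 0 < r \<longrightarrow> ennreal t * emeasure lebesgue (cube c r) \<le> a \<longrightarrow> r \<le> B"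
proof -
  obtain a' where a': "a = ennreal a'" "0 \<le> a'" using fin by (cases a) auto
  define w where "w = sqrt (real CARD('d))"
  have w: "0 < w" by (simp add: w_def)
  have "r \<le> w * max 1 (a' / t)"
    if r: "0 < r" and le: "ennreal t * emeasure lebesgue (cube c r) \<le> a" for c :: "real ^ 'd" and r
  proof (rule ccontr)
    assume "\<not> ?thesis"
    then have "w * max 1 (a' / t) < r" by simp
    then have "max 1 (a' / t) < r / w" using w by (simp only: pos_less_divide_eq mult.commute)
    then have "1 < r / w" "a' / t < r / w" by simp_all
    then have 1: "1 \<le> r / w" "a' < t * (r / w)" using t
      by (simp_all only: less_imp_le pos_divide_less_eq mult.commute)
    have "r / w \<le> (r / w) ^ CARD('d)" using 1 by (intro self_le_power) auto
    with 1 t have "a' < t * (r / w) ^ CARD('d)"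
      by (meson less_le_trans mult_le_cancel_left_pos)
    moreover have "ennreal (t * (r / w) ^ CARD('d)) \<le> ennreal a'"
      using le r t w by (simp add: emeasure_cube a' w_def ennreal_mult[symmetric] del: emeasure_completion)
    ultimately show False using a'(2) by simp
  qed
  then show ?thesis by blast
qed

lemma weak_type:
  fixes H :: "real ^ 'd \<Rightarrow> ennreal"
  assumes H [measurable]: "H \<in> borel_measurable lebesgue"
    and fin: "(\<integral>\<^sup>+y. H y \<partial>lebesgue) < \<infinity>" and t: "0 < t"
  shows "emeasure lebesgue (superlevel H t)
      \<le> ennreal (vitali_factor TYPE('d) ^ CARD('d) / t) * (\<integral>\<^sup>+y. H y \<partial>lebesgue)"
proof -
  define I where "I = {(c :: real ^ 'd, r). 0 < r \<and>
    ennreal t * emeasure lebesgue (cube c r) < (\<integral>\<^sup>+y\<in>cube c r. H y \<partial>lebesgue)}"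
  define k where "k = vitali_factor TYPE('d)"
  have k: "0 < k" using vitali_factor_ge[where 'd = 'd] by (simp add: k_def)
  have le: "(\<integral>\<^sup>+y\<in>S. H y \<partial>lebesgue) \<le> (\<integral>\<^sup>+y. H y \<partial>lebesgue)" for S
    by (intro nn_integral_mono) (auto simp: indicator_def)
  obtain B where B: "\<And>c r. (c, r) \<in> I \<Longrightarrow> r \<le> B"
  proof -
    obtain B where B: "\<forall>(c :: real ^ 'd) r. 0 < r \<longrightarrow>
        ennreal t * emeasure lebesgue (cube c r) \<le> (\<integral>\<^sup>+y. H y \<partial>lebesgue) \<longrightarrow> r \<le> B"
      using cube_diam_bounded[OF fin t] by blast
    show thesis
    proof (rule that)
      fix c r assume "(c, r) \<in> I"
      then have "0 < r" "ennreal t * emeasure lebesgue (cube c r) < (\<integral>\<^sup>+y\<in>cube c r. H y \<partial>lebesgue)"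
        unfolding I_def by blast+
      with B le[of "cube c r"] show "r \<le> B" by (meson less_imp_le order_trans)
    qed
  qed
  have "emeasure lebesgue (UNIV \<inter> (\<Union>(c, r)\<in>I. cube c r))
      \<le> ennreal (k ^ CARD('d) / t) * (\<integral>\<^sup>+y\<in>UNIV. H y \<partial>lebesgue)"
  proof (rule emeasure_cubes_le_of_dilates)
    show "0 < r \<and> r \<le> B" if "(c, r) \<in> I" for c r
      using that B by (auto simp: I_def)
    show "emeasure lebesgue (UNIV \<inter> cube c (vitali_factor TYPE('d) * r))
        \<le> ennreal (k ^ CARD('d) / t) * (\<integral>\<^sup>+y\<in>cube c r. H y \<partial>lebesgue)" if "(c, r) \<in> I" for c r
    proof -
      have r: "0 < r" and big: "ennreal t * emeasure lebesgue (cube c r) \<le> (\<integral>\<^sup>+y\<in>cube c r. H y \<partial>lebesgue)"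
        using that by (auto simp: I_def)
      have "emeasure lebesgue (UNIV \<inter> cube c (vitali_factor TYPE('d) * r))
          = ennreal (k ^ CARD('d)) * emeasure lebesgue (cube c r)"
        using emeasure_cube_dilate[OF r k, of c c] by (simp only: k_def Int_UNIV_left)
      also have "ennreal (k ^ CARD('d)) = ennreal (k ^ CARD('d) / t) * ennreal t"
        using k t by (simp add: ennreal_mult[symmetric])
      also have "\<dots> * emeasure lebesgue (cube c r)
          = ennreal (k ^ CARD('d) / t) * (ennreal t * emeasure lebesgue (cube c r))"
        by (simp add: mult.assoc)
      also have "\<dots> \<le> ennreal (k ^ CARD('d) / t) * (\<integral>\<^sup>+y\<in>cube c r. H y \<partial>lebesgue)"
        by (intro mult_left_mono big) simp
      finally show ?thesis .
    qed
  qed auto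
  also have "UNIV \<inter> (\<Union>(c, r)\<in>I. cube c r) = superlevel H t"
    by (simp add: I_def superlevel_def)
  finally show ?thesis by (simp add: k_def)
qed

text \<open>
  The part of \<open>H\<close> below \<open>t/2\<close> contributes at most \<open>t/2\<close> to any mean, so a mean above \<open>t\<close> forces the
  part above \<open>t/2\<close> to have a mean above \<open>t/2\<close>. Retaining only this part of \<open>H\<close> in the weak type
  bound is what makes the bounds summable over levels.
\<close>

lemma weak_type_truncated:
  fixes H :: "real ^ 'd \<Rightarrow> ennreal"
  assumes H [measurable]: "H \<in> borel_measurable lebesgue"
    and fin: "(\<integral>\<^sup>+y. H y \<partial>lebesgue) < \<infinity>" and t: "0 < t"
  shows "emeasure lebesgue (superlevel H t)
      \<le> ennreal (2 * vitali_factor TYPE('d) ^ CARD('d) / t) *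
        (\<integral>\<^sup>+y\<in>{y. ennreal (t / 2) < H y}. H y \<partial>lebesgue)"
proof -
  define H1 where "H1 y = H y * indicator {y. ennreal (t / 2) < H y} y" for y
  have [measurable]: "H1 \<in> borel_measurable lebesgue"
    unfolding H1_def by measurable
  have fin1: "(\<integral>\<^sup>+y. H1 y \<partial>lebesgue) < \<infinity>"
    by (rule le_less_trans[OF nn_integral_mono fin]) (auto simp: H1_def indicator_def)
  have sub: "superlevel H t \<subseteq> superlevel H1 (t / 2)"
  proof
    fix x assume "x \<in> superlevel H t"
    then obtain c r where r: "0 < r" "x \<in> cube c r"
      and big: "ennreal t * emeasure lebesgue (cube c r) < (\<integral>\<^sup>+y\<in>cube c r. H y \<partial>lebesgue)"
      by (auto simp: mem_superlevel)
    let ?m = "emeasure lebesgue (cube c r)"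
    have "(\<integral>\<^sup>+y\<in>cube c r. H y \<partial>lebesgue)
        \<le> (\<integral>\<^sup>+y. H1 y * indicator (cube c r) y + ennreal (t / 2) * indicator (cube c r) y \<partial>lebesgue)"
      by (intro nn_integral_mono) (auto simp: H1_def indicator_def)
    also have "\<dots> = (\<integral>\<^sup>+y\<in>cube c r. H1 y \<partial>lebesgue) + ennreal (t / 2) * ?m"
      by (subst nn_integral_add) (auto simp: nn_integral_cmult_indicator)
    finally have "ennreal t * ?m < (\<integral>\<^sup>+y\<in>cube c r. H1 y \<partial>lebesgue) + ennreal (t / 2) * ?m"
      using big by (rule less_le_trans[rotated])
    moreover have "ennreal t * ?m = ennreal (t / 2) * ?m + ennreal (t / 2) * ?m"
      using t by (simp add: distrib_right[symmetric] ennreal_plus[symmetric] del: ennreal_plus)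
    ultimately have "ennreal (t / 2) * ?m + ennreal (t / 2) * ?m
        < ennreal (t / 2) * ?m + (\<integral>\<^sup>+y\<in>cube c r. H1 y \<partial>lebesgue)"
      by (simp add: add.commute)
    then have "ennreal (t / 2) * ?m < (\<integral>\<^sup>+y\<in>cube c r. H1 y \<partial>lebesgue)"
      by (meson add_left_mono not_le)
    with r show "x \<in> superlevel H1 (t / 2)" by (rule superlevelI)
  qed
  have "emeasure lebesgue (superlevel H t) \<le> emeasure lebesgue (superlevel H1 (t / 2))"
    by (rule emeasure_mono[OF sub]) simp
  also have "\<dots> \<le> ennreal (vitali_factor TYPE('d) ^ CARD('d) / (t / 2)) * (\<integral>\<^sup>+y. H1 y \<partial>lebesgue)"
    by (rule weak_type) (use fin1 t in auto)
  finally show ?thesis by (simp add: H1_def mult.commute)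
qed

lemma ennreal_set_integral:
  fixes G :: "'a \<Rightarrow> real"
  assumes int: "integrable M G" and nonneg: "\<And>x. 0 \<le> G x" and S: "S \<in> sets M"
  shows "ennreal (LINT y:S|M. G y) = (\<integral>\<^sup>+y\<in>S. ennreal (G y) \<partial>M)"
proof -
  have "ennreal (LINT y:S|M. G y) = (\<integral>\<^sup>+y. ennreal (indicator S y *\<^sub>R G y) \<partial>M)"
    unfolding set_lebesgue_integral_def
    using int S nonneg by (intro nn_integral_eq_integral[symmetric] integrable_mult_indicator) auto
  also have "\<dots> = (\<integral>\<^sup>+y\<in>S. ennreal (G y) \<partial>M)"
    by (intro nn_integral_cong) (auto simp: indicator_def)
  finally show ?thesis .
qed

text \<open>
  Lebesgue differentiation: \<open>G \<le> M G\<close> almost everywhere. The differentiation theorem is about closed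
  cubes with \<open>x\<close> as lower corner; the strict inequality leaves room to enlarge such a cube to an
  open one that contains \<open>x\<close>.
\<close>

lemma AE_le_off_superlevel:
  fixes G :: "real ^ 'd \<Rightarrow> real"
  assumes int: "integrable lebesgue G" and nonneg: "\<And>x. 0 \<le> G x"
  shows "AE x in lebesgue. \<forall>t\<ge>0. t < G x \<longrightarrow> x \<in> superlevel (\<lambda>y. ennreal (G y)) t"
proof -
  have io: "G integrable_on cbox a b" for a b
    using int by (intro integrable_on_subcbox[of G UNIV]) 
      (auto simp: integrable_on_lebesgue)
  obtain N where N: "negligible N" and lim: "\<And>x e. x \<notin> N \<Longrightarrow> 0 < e \<Longrightarrow>
      \<exists>d>0. \<forall>h. 0 < h \<and> h < d \<longrightarrow>
        norm (integral (cbox x (x + h *\<^sub>R One)) G /\<^sub>R h ^ DIM(real ^ 'd) - G x) < e"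
    using integrable_ccontinuous_explicit[of G] io by blast
  have mem: "x \<in> superlevel (\<lambda>y. ennreal (G y)) t" if x: "x \<notin> N" and t: "0 \<le> t" "t < G x" for x t
  proof -
    let ?n = "CARD('d)" and ?w = "sqrt (real CARD('d))"
    obtain h where h: "0 < h" and "norm (integral (cbox x (x + h *\<^sub>R One)) G /\<^sub>R h ^ DIM(real ^ 'd) - G x) < G x - t"
      using lim[OF x, of "G x - t"] t by (metis dense diff_gt_0_iff_gt)
    then have "t < integral (cbox x (x + h *\<^sub>R One)) G / h ^ ?n"
      by (auto simp: divide_inverse mult.commute abs_if split: if_splits)
    then have big: "t * h ^ ?n < integral (cbox x (x + h *\<^sub>R One)) G"
      using h by (simp add: pos_less_divide_eq)
    \<comment> \<open>a slightly longer side \<open>u\<close> keeps the mean above \<open>t\<close>\<close>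
    have "((\<lambda>u. t * u ^ ?n) \<longlongrightarrow> t * h ^ ?n) (at_right h)"
      by (intro tendsto_intros)
    then have "\<forall>\<^sub>F u in at_right h. t * u ^ ?n < integral (cbox x (x + h *\<^sub>R One)) G"
      using big by (rule order_tendstoD)
    moreover have "\<forall>\<^sub>F u in at_right h. h < u" by (simp add: eventually_at_right_less)
    ultimately obtain u where u: "h < u" "t * u ^ ?n < integral (cbox x (x + h *\<^sub>R One)) G"
      by (metis (mono_tags, lifting) eventually_conj eventually_happens trivial_limit_at_right_real)
    define c where "c = x + (\<chi> i. h / 2)"
    have w: "0 < ?w" by simp
    have sub: "cbox x (x + h *\<^sub>R One) \<subseteq> cube c (u * ?w)"
    proof
      fix y assume "y \<in> cbox x (x + h *\<^sub>R One)"
      then have "x \<bullet> axis i 1 \<le> y \<bullet> axis i 1 \<and> y \<bullet> axis i 1 \<le> (x + h *\<^sub>R One) \<bullet> axis i 1" for i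
        by (auto simp: mem_box)
      moreover have "(x + h *\<^sub>R One) \<bullet> axis i 1 = x \<bullet> axis i 1 + h" for i
        using inner_sum_left_Basis[of "axis i 1 :: real ^ 'd"]
        by (simp only: inner_add_left inner_scaleR_left) (simp add: axis_in_Basis_iff)
      ultimately have y: "x $ i \<le> y $ i" "y $ i \<le> x $ i + h" for i
        by (simp_all only: cart_eq_inner_axis[symmetric])
      then show "y \<in> cube c (u * ?w)" unfolding mem_cube
        using u(1) w h by (auto simp: c_def abs_less_iff algebra_simps) (smt (verit) y field_sum_of_halves)+
    qed
    have uw: "0 < u * ?w" using u h w by simp
    have "ennreal t * emeasure lebesgue (cube c (u * ?w)) = ennreal (t * u ^ ?n)"
      unfolding emeasure_cube[OF uw] using u h t by (simp add: ennreal_mult[symmetric])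
    also have "\<dots> < ennreal (integral (cbox x (x + h *\<^sub>R One)) G)"
      using u(2) t h u(1) by (intro ennreal_lessI) (auto intro: le_less_trans[rotated])
    also have "ennreal (integral (cbox x (x + h *\<^sub>R One)) G)
        = (\<integral>\<^sup>+y\<in>cbox x (x + h *\<^sub>R One). ennreal (G y) \<partial>lebesgue)"
    proof -
      have "set_integrable lebesgue (cbox x (x + h *\<^sub>R One)) G"
        unfolding set_integrable_def by (rule integrable_mult_indicator[OF _ int]) simp
      then have "integral (cbox x (x + h *\<^sub>R One)) G = (LINT y:cbox x (x + h *\<^sub>R One)|lebesgue. G y)"
        by (simp add: set_lebesgue_integral_eq_integral)
      then show ?thesis using ennreal_set_integral[OF int nonneg] by simp
    qed
    also have "\<dots> \<le> (\<integral>\<^sup>+y\<in>cube c (u * ?w). ennreal (G y) \<partial>lebesgue)"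
      using sub by (intro nn_integral_mono) (auto simp: indicator_def)
    finally show ?thesis
    proof (rule superlevelI[rotated 2])
      show "x \<in> cube c (u * ?w)" using sub h by (auto simp: mem_box subset_iff inner_add_left)
    qed (use u h w in auto)
  qed
  have "N \<in> null_sets lebesgue" using N by (simp add: negligible_iff_null_sets)
  then show ?thesis by (rule AE_I') (use mem in auto)
qed

section \<open>Passing from many high points to a full cube\<close>

lemma set_integral_le_off_superlevel:
  fixes F :: "real ^ 'd \<Rightarrow> real"
  assumes int: "integrable lebesgue F" and nonneg: "\<And>x. 0 \<le> F x"
    and t: "0 \<le> t" and r: "0 < r"
    and x: "x \<notin> superlevel (\<lambda>y. ennreal (F y)) t" "x \<in> cube c r"
  shows "(LINT y:cube c r|lebesgue. F y) \<le> t * measure lebesgue (cube c r)"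
proof -
  have "ennreal (LINT y:cube c r|lebesgue. F y) = (\<integral>\<^sup>+y\<in>cube c r. ennreal (F y) \<partial>lebesgue)"
    by (rule ennreal_set_integral[OF int nonneg sets_cube])
  also have "\<dots> \<le> ennreal t * emeasure lebesgue (cube c r)"
    by (rule average_le_off_superlevel[OF x(1) r x(2)])
  also have "\<dots> = ennreal (t * measure lebesgue (cube c r))"
    unfolding emeasure_cube[OF r] measure_cube[OF r] using t r by (simp add: ennreal_mult)
  finally show ?thesis
    using t by (simp add: ennreal_le_iff)
qed

text \<open>
  The hypothesis of the extrapolation theorem in terms of \<open>F = |f|^2\<close> and \<open>G = |T(f)|^2\<close>, with \<open>b\<close> in
  the place of \<open>\<alpha>\<^sub>2\<close>.
\<close>

definition local_estimate ::
  "real \<Rightarrow> real \<Rightarrow> real \<Rightarrow> (real ^ 'd \<Rightarrow> real) \<Rightarrow> (real ^ 'd \<Rightarrow> real) \<Rightarrow> bool" where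
  "local_estimate K b q F G \<longleftrightarrow>
     (\<forall>\<iota>>0. \<forall>x0 r x' r'. is_parent x' r' x0 r \<longrightarrow>
        measure lebesgue {x \<in> cube x0 r. local_maximal (cube x' (2 * r')) G x > ennreal \<iota>}
        \<le> K / \<iota> * (LINT x:cube x' (2 * b * r')|lebesgue. F x)
          + K * measure lebesgue (cube x0 r) / \<iota> powr (q / 2) *
            (sqrt (1 / measure lebesgue (cube x0 r) * (LINT x:cube x' (2 * b * r')|lebesgue. G x))
             + (SUP Q \<in> {Q \<in> cubes. cube x' (2 * r') \<subseteq> Q}.
                  sqrt (1 / measure lebesgue Q * (LINT x:Q|lebesgue. F x)))) powr q)"

text \<open>
  Any one of the \<open>2^d\<close> parents serves below; this is the one that has \<open>cube x r\<close> in its lower corner.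
\<close>

lemma is_parent_upper_corner:
  fixes x :: "real ^ 'd"
  assumes r: "0 < r"
  defines "h \<equiv> r / (2 * sqrt (real CARD('d)))"
  shows "is_parent (x + (\<chi> i. h)) (2 * r) x r"
proof -
  have h: "0 < h" using r by (simp add: h_def)
  have "2 * r / (2 * sqrt (real CARD('d))) = 2 * h" by (simp add: h_def)
  then have "cube x r = {y \<in> cube (x + (\<chi> i. h)) (2 * r).
      \<forall>i. if i \<in> UNIV then y $ i < (x + (\<chi> i. h)) $ i else (x + (\<chi> i. h)) $ i < y $ i}"
    using h unfolding mem_cube set_eq_iff mem_Collect_eq h_def[symmetric]
    by (auto simp: abs_less_iff all_conj_distrib[symmetric]) (smt (verit))+
  then have "cube x r \<in> children (x + (\<chi> i. h)) (2 * r)"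
    unfolding children_def mem_Collect_eq by (intro exI[of _ UNIV] conjI TrueI)
  then show ?thesis
    unfolding is_parent_def using r by simp
qed

text \<open>
  The localization step. Let \<open>R\<close> be a cube through \<open>y\<close> on which the mean of \<open>G\<close> exceeds \<open>A l\<close>. If \<open>R\<close>
  left \<open>2 Q*\<close>, its half side \<open>k\<close> would exceed that of \<open>Q\<close>, so \<open>3 R\<close> would contain \<open>z\<close>. The mean of \<open>G\<close>
  over \<open>3 R\<close> would then be at most \<open>l\<close>, and that over \<open>R\<close> at most \<open>3^d l\<close>.
\<close>

lemma superlevel_subset_local:
  fixes x :: "real ^ 'd" and G :: "real ^ 'd \<Rightarrow> real"
  assumes r: "0 < r" and z: "z \<in> cube x r" "z \<notin> superlevel (\<lambda>y. ennreal (G y)) l"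
    and A: "3 ^ CARD('d) \<le> A" and l: "0 < l" and nonneg: "\<And>x. 0 \<le> G x"
  defines "h \<equiv> r / (2 * sqrt (real CARD('d)))"
  assumes y: "y \<in> cube x r" "y \<in> superlevel (\<lambda>y. ennreal (G y)) (A * l)"
  shows "ennreal (A * l) < local_maximal (cube (x + (\<chi> i. h)) (2 * (2 * r))) G y"
proof -
  let ?w = "2 * sqrt (real CARD('d))" and ?n = "CARD('d)"
  have w: "0 < ?w" by simp
  obtain c \<rho> where \<rho>: "0 < \<rho>" "y \<in> cube c \<rho>"
    and big: "ennreal (A * l) * emeasure lebesgue (cube c \<rho>) < (\<integral>\<^sup>+y\<in>cube c \<rho>. ennreal (G y) \<partial>lebesgue)"
    using y(2) by (auto simp only: mem_superlevel)
  define k where "k = \<rho> / ?w"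
  have \<rho>': "0 < 3 * \<rho>" using \<rho> by simp
  have sub: "cube c \<rho> \<subseteq> cube (x + (\<chi> i. h)) (2 * (2 * r))"
  proof (rule ccontr)
    assume "\<not> ?thesis"
    then obtain v where v: "v \<in> cube c \<rho>" "v \<notin> cube (x + (\<chi> i. h)) (2 * (2 * r))" by blast
    have "2 * (2 * r) / ?w = 4 * h" by (simp add: h_def)
    then obtain i where i: "4 * h \<le> \<bar>v $ i - (x $ i + h)\<bar>"
      using v(2) unfolding mem_cube by (auto simp: not_less)
    have "\<bar>y $ i - x $ i\<bar> < h" "\<bar>v $ i - c $ i\<bar> < k" "\<bar>y $ i - c $ i\<bar> < k"
      using y(1) v(1) \<rho>(2) unfolding mem_cube h_def k_def by blast+
    then have hk: "h < k" using i by linarith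
    have "z \<in> cube c (3 * \<rho>)"
      unfolding mem_cube
    proof
      fix j
      have "\<bar>y $ j - x $ j\<bar> < h" "\<bar>z $ j - x $ j\<bar> < h" "\<bar>y $ j - c $ j\<bar> < k"
        using y(1) z(1) \<rho>(2) unfolding mem_cube h_def k_def by blast+
      then have "\<bar>z $ j - c $ j\<bar> < 3 * k" using hk by linarith
      then show "\<bar>z $ j - c $ j\<bar> < 3 * \<rho> / ?w" by (simp add: k_def)
    qed
    then have "(\<integral>\<^sup>+y\<in>cube c (3 * \<rho>). ennreal (G y) \<partial>lebesgue)
        \<le> ennreal l * emeasure lebesgue (cube c (3 * \<rho>))"
      by (rule average_le_off_superlevel[OF z(2) \<rho>'])
    also have "\<dots> = ennreal (l * 3 ^ ?n) * emeasure lebesgue (cube c \<rho>)"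
      using l emeasure_cube_dilate[OF \<rho>(1), of 3 c c]
      by (simp add: ennreal_mult mult.assoc del: emeasure_completion)
    also have "\<dots> \<le> ennreal (A * l) * emeasure lebesgue (cube c \<rho>)"
      using A l by (intro mult_right_mono ennreal_leI) auto
    also have "\<dots> < (\<integral>\<^sup>+y\<in>cube c \<rho>. ennreal (G y) \<partial>lebesgue)" by (rule big)
    also have "\<dots> \<le> (\<integral>\<^sup>+y\<in>cube c (3 * \<rho>). ennreal (G y) \<partial>lebesgue)"
    proof (intro nn_integral_mono)
      fix y
      have "y \<in> cube c \<rho> \<Longrightarrow> y \<in> cube c (3 * \<rho>)"
        unfolding mem_cube using \<rho>(1) w
        by (meson divide_right_mono less_le_trans less_imp_le mult_le_cancel_right1 one_le_numeral not_less)
      then show "ennreal (G y) * indicator (cube c \<rho>) y \<le> ennreal (G y) * indicator (cube c (3 * \<rho>)) y"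
        by (auto simp: indicator_def)
    qed
    finally show False by simp
  qed
  have "ennreal (A * l) < (\<integral>\<^sup>+y\<in>cube c \<rho>. ennreal \<bar>G y\<bar> \<partial>lebesgue) / emeasure lebesgue (cube c \<rho>)"
  proof -
    define m where "m = measure lebesgue (cube c \<rho>)"
    have m: "0 < m" "emeasure lebesgue (cube c \<rho>) = ennreal m"
      using measure_cube_pos[OF \<rho>(1), of c] emeasure_cube[OF \<rho>(1), of c] measure_cube[OF \<rho>(1), of c]
      by (auto simp only: m_def)
    let ?X = "\<integral>\<^sup>+y\<in>cube c \<rho>. ennreal (G y) \<partial>lebesgue"
    have "?X / ennreal m * ennreal m = ?X"
      using m(1) by (simp add: ennreal_divide_times)
    then have "\<not> ?X / ennreal m \<le> ennreal (A * l)"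
      using big mult_right_mono[of "?X / ennreal m" "ennreal (A * l)" "ennreal m"]
      unfolding m(2) by (metis not_le zero_le)
    then show ?thesis
      using nonneg unfolding m(2) by (simp add: not_le)
  qed
  also have "\<dots> \<le> local_maximal (cube (x + (\<chi> i. h)) (2 * (2 * r))) G y"
    unfolding local_maximal_def
    using \<rho> sub by (intro SUP_upper) (auto simp: cubes_def)
  finally show ?thesis .
qed

lemma sets_local_superlevel:
  "{x \<in> cube c r. ennreal t < local_maximal A G x} \<in> sets lebesgue"
proof -
  have "{x \<in> cube c r. ennreal t < local_maximal A G x} = cube c r \<inter>
      \<Union>{R \<in> cubes. R \<subseteq> A \<and> ennreal t < (\<integral>\<^sup>+ y \<in> R. ennreal \<bar>G y\<bar> \<partial>lebesgue) / emeasure lebesgue R}"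
    unfolding local_maximal_def less_SUP_iff by blast
  moreover have "open \<dots>"
    by (intro open_Int open_Union open_cube) (auto simp: cubes_def open_cube)
  ultimately show ?thesis using sets_open by metis
qed

text \<open>
  If a point \<open>z\<close> of \<open>Q = cube x r\<close> had \<open>M G z \<le> l\<close>, the local estimate would apply at level \<open>A l\<close> with
  all its means under control: those of \<open>F\<close> by \<open>\<gamma> l\<close>, as their cubes contain \<open>x\<close>, and that of \<open>G\<close> by
  \<open>l\<close>, as its cube contains \<open>z\<close>. Powers of \<open>l\<close> cancel, and what remains is a share of at
  most \<open>\<delta>\<close>. The factor \<open>(4 b)^d\<close> is the ratio of the measures of \<open>2 b Q*\<close> and \<open>Q\<close>.
\<close>

lemma cube_subset_superlevel:
  fixes F G :: "real ^ 'd \<Rightarrow> real"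
  assumes F: "integrable lebesgue F" "\<And>x. 0 \<le> F x"
    and G: "integrable lebesgue G" "\<And>x. 0 \<le> G x"
    and b: "1 < b" and K: "0 < K" and q: "0 < q" and \<gamma>: "0 < \<gamma>" "\<gamma> \<le> 1"
    and A: "3 ^ CARD('d) \<le> A" and l: "0 < l"
    and est: "local_estimate K b q F G"
    and const: "K * \<gamma> * (4 * b) ^ CARD('d) / A
        + K * (2 * sqrt ((4 * b) ^ CARD('d))) powr q / A powr (q / 2) \<le> \<delta>"
    and r: "0 < r" and x: "x \<notin> superlevel (\<lambda>y. ennreal (F y)) (\<gamma> * l)"
    and big: "\<delta> * measure lebesgue (cube x r)
        < measure lebesgue (superlevel (\<lambda>y. ennreal (G y)) (A * l) \<inter> cube x r)"
  shows "cube x r \<subseteq> superlevel (\<lambda>y. ennreal (G y)) l"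
proof (rule ccontr)
  assume "\<not> ?thesis"
  then obtain z where z: "z \<in> cube x r" "z \<notin> superlevel (\<lambda>y. ennreal (G y)) l" by blast
  define h where "h = r / (2 * sqrt (real CARD('d)))"
  define x' where "x' = x + (\<chi> i. h)"
  define L where "L = (4 * b) ^ CARD('d)"
  define m where "m = measure lebesgue (cube x r)"
  have h: "0 < h" using r by (simp add: h_def)
  have L: "1 \<le> L" unfolding L_def using b by (intro one_le_power) simp
  have m: "0 < m" unfolding m_def by (rule measure_cube_pos[OF r])
  have A0: "0 < A" using A by (smt (verit) zero_less_power)
  have Al: "0 < A * l" using A0 l by simp
  have par: "is_parent x' (2 * r) x r"
    unfolding x'_def h_def by (rule is_parent_upper_corner[OF r])
  have r4: "0 < 2 * b * (2 * r)" using r b by simp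
  have m4: "measure lebesgue (cube x' (2 * b * (2 * r))) = L * m"
    using measure_cube_dilate[OF r, of "4 * b" x' x] b by (simp add: L_def m_def algebra_simps)
  have near: "y \<in> cube x' (s * (2 * r))" if "y \<in> cube x r" "1 \<le> s" for y s
    unfolding mem_cube
  proof
    fix i
    have "\<bar>y $ i - x $ i\<bar> < h" using that by (simp add: mem_cube h_def)
    then have "\<bar>y $ i - x' $ i\<bar> < 1 * (2 * h)" by (simp add: x'_def)
    also have "\<dots> \<le> s * (2 * h)" using that h by (intro mult_right_mono) auto
    also have "\<dots> = s * (2 * r) / (2 * sqrt (real CARD('d)))" by (simp add: h_def)
    finally show "\<bar>y $ i - x' $ i\<bar> < s * (2 * r) / (2 * sqrt (real CARD('d)))" .
  qed
  have xc: "x \<in> cube x r" by (rule center_in_cube[OF r])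
  have intF: "(LINT y:cube x' (2 * b * (2 * r))|lebesgue. F y) \<le> \<gamma> * l * (L * m)"
    using set_integral_le_off_superlevel[OF F _ r4 x near[OF xc]] \<gamma> l b m4 by simp
  have intG: "(LINT y:cube x' (2 * b * (2 * r))|lebesgue. G y) \<le> l * (L * m)"
    using set_integral_le_off_superlevel[OF G _ r4 z(2) near[OF z(1)]] l b m4 by simp
  let ?Q = "{Q \<in> cubes. cube x' (2 * (2 * r)) \<subseteq> Q}"
  let ?f = "\<lambda>Q. sqrt (1 / measure lebesgue Q * (LINT x:Q|lebesgue. F x))"
  have nn: "0 \<le> (LINT y:S|lebesgue. F y)" "0 \<le> (LINT y:S|lebesgue. G y)" for S
    using F(2) G(2) unfolding set_lebesgue_integral_def by (auto intro!: integral_nonneg)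
  have Q0: "cube x' (2 * (2 * r)) \<in> ?Q" using r unfolding cubes_def by force
  have bd: "?f Q \<le> sqrt (\<gamma> * l)" if QQ: "Q \<in> ?Q" for Q
  proof -
    obtain c \<rho> where Q: "Q = cube c \<rho>" "0 < \<rho>" "cube x' (2 * (2 * r)) \<subseteq> cube c \<rho>"
      using QQ unfolding cubes_def by blast
    have "(LINT y:Q|lebesgue. F y) \<le> \<gamma> * l * measure lebesgue Q"
      unfolding Q(1) using near[OF xc, of 2] Q \<gamma> l
      by (intro set_integral_le_off_superlevel[OF F _ _ x]) auto
    then have "1 / measure lebesgue Q * (LINT y:Q|lebesgue. F y) \<le> \<gamma> * l"
      using measure_cube_pos[OF Q(2), of c] unfolding Q(1) by (simp add: field_simps)
    then show ?thesis by (rule real_sqrt_le_mono)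
  qed
  have sup: "(SUP Q \<in> ?Q. ?f Q) \<le> sqrt (\<gamma> * l)"
    using Q0 by (intro cSUP_least bd) auto
  \<comment> \<open>A nonnegative base is needed for the monotonicity of \<open>powr\<close>.\<close>
  have sup0: "0 \<le> (SUP Q \<in> ?Q. ?f Q)"
  proof -
    have "0 \<le> ?f (cube x' (2 * (2 * r)))" using nn by simp
    also have "\<dots> \<le> (SUP Q \<in> ?Q. ?f Q)"
      by (intro cSUP_upper Q0 bdd_aboveI2[where M = "sqrt (\<gamma> * l)"] bd)
    finally show ?thesis .
  qed
  let ?S = "{y \<in> cube x r. local_maximal (cube x' (2 * (2 * r))) G y > ennreal (A * l)}"
  have "\<delta> * m < measure lebesgue (superlevel (\<lambda>y. ennreal (G y)) (A * l) \<inter> cube x r)"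
    using big by (simp add: m_def)
  also have "\<dots> \<le> measure lebesgue ?S"
  proof (rule measure_mono_fmeasurable)
    show "superlevel (\<lambda>y. ennreal (G y)) (A * l) \<inter> cube x r \<subseteq> ?S"
      using superlevel_subset_local[OF r z A l G(2)] unfolding x'_def h_def by blast
    show "?S \<in> fmeasurable lebesgue"
      by (rule fmeasurableI2[of "cube x r"])
         (use emeasure_cube_finite sets_cube sets_local_superlevel in \<open>auto intro!: fmeasurableI\<close>)
  qed simp
  also have "\<dots> \<le> K / (A * l) * (LINT y:cube x' (2 * b * (2 * r))|lebesgue. F y)
      + K * m / (A * l) powr (q / 2) *
        (sqrt (1 / m * (LINT y:cube x' (2 * b * (2 * r))|lebesgue. G y))
         + (SUP Q \<in> ?Q. ?f Q)) powr q"
    unfolding m_def by (rule est[unfolded local_estimate_def, rule_format, OF Al par])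
  also have "\<dots> \<le> K / (A * l) * (\<gamma> * l * (L * m))
      + K * m / (A * l) powr (q / 2) * (2 * sqrt (l * L)) powr q"
  proof (intro add_mono mult_left_mono intF powr_mono2)
    have "sqrt (1 / m * (LINT y:cube x' (2 * b * (2 * r))|lebesgue. G y)) \<le> sqrt (l * L)"
      using intG m by (intro real_sqrt_le_mono) (simp add: field_simps)
    moreover have "sqrt (\<gamma> * l) \<le> sqrt (l * L)"
      using \<gamma> L l by (intro real_sqrt_le_mono) (simp add: mult.commute)
    ultimately show "sqrt (1 / m * (LINT y:cube x' (2 * b * (2 * r))|lebesgue. G y))
        + (SUP Q \<in> ?Q. ?f Q) \<le> 2 * sqrt (l * L)"
      using sup by linarith
    show "0 \<le> sqrt (1 / m * (LINT y:cube x' (2 * b * (2 * r))|lebesgue. G y))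
        + (SUP Q \<in> ?Q. ?f Q)"
      using nn m sup0 by (intro add_nonneg_nonneg) auto
  qed (use K A0 l m q in auto)
  also have "\<dots> = (K * \<gamma> * L / A + K * (2 * sqrt L) powr q / A powr (q / 2)) * m"
  proof -
    have "(2 * sqrt (l * L)) powr q = (sqrt l) powr q * (2 * sqrt L) powr q"
      using l L by (simp add: real_sqrt_mult powr_mult mult_ac)
    also have "(sqrt l) powr q = l powr (q / 2)"
      using l by (simp add: powr_half_sqrt[symmetric] powr_powr)
    finally have e: "(2 * sqrt (l * L)) powr q = l powr (q / 2) * (2 * sqrt L) powr q" .
    show ?thesis unfolding e using l A0 by (simp add: powr_mult field_simps)
  qed
  also have "\<dots> \<le> \<delta> * m"
    using const m by (intro mult_right_mono) (auto simp: L_def)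
  finally show False by simp
qed

section \<open>The good-lambda inequality\<close>

text \<open>
  A stopping time argument. Around a point of \<open>E = {M G > A l}\<close> the small cubes lie in the open set
  \<open>E\<close>, whereas \<open>E\<close> has finite measure and cannot be dense in a very large cube. So there is a cube in
  which \<open>E\<close> has density more than \<open>\<delta>\<close> while it has density at most \<open>\<delta>\<close> in the Vitali dilate. Off
  \<open>{M F > \<gamma> l}\<close> such a cube lies in \<open>{M G > l}\<close> by assumption, and the covering argument
  applies.
\<close>

lemma good_lambda:
  fixes F G :: "real ^ 'd \<Rightarrow> real"
  assumes G: "integrable lebesgue G" "\<And>x. 0 \<le> G x"
    and l: "0 < A * l" and \<delta>: "0 < \<delta>" "\<delta> < 1"
    and key: "\<And>x r. 0 < r \<Longrightarrow> x \<notin> superlevel (\<lambda>y. ennreal (F y)) (\<gamma> * l) \<Longrightarrow>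
      \<delta> * measure lebesgue (cube x r)
        < measure lebesgue (superlevel (\<lambda>y. ennreal (G y)) (A * l) \<inter> cube x r) \<Longrightarrow>
      cube x r \<subseteq> superlevel (\<lambda>y. ennreal (G y)) l"
  shows "emeasure lebesgue (superlevel (\<lambda>y. ennreal (G y)) (A * l))
      \<le> ennreal (\<delta> * vitali_factor TYPE('d) ^ CARD('d)) *
          emeasure lebesgue (superlevel (\<lambda>y. ennreal (G y)) l)
        + emeasure lebesgue (superlevel (\<lambda>y. ennreal (F y)) (\<gamma> * l))"
proof -
  define E where "E = superlevel (\<lambda>y. ennreal (G y)) (A * l)"
  define U where "U = superlevel (\<lambda>y. ennreal (G y)) l"
  define N where "N = superlevel (\<lambda>y. ennreal (F y)) (\<gamma> * l)"
  define k where "k = vitali_factor TYPE('d)"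
  have k: "2 \<le> k" "0 < k" using vitali_factor_ge[where 'd = 'd] by (auto simp: k_def)
  have sets [measurable]: "E \<in> sets lebesgue" "U \<in> sets lebesgue" "N \<in> sets lebesgue"
    unfolding E_def U_def N_def by simp_all
  have [measurable]: "G \<in> borel_measurable lebesgue" using G(1) by (rule borel_measurable_integrable)
  have finG: "(\<integral>\<^sup>+y. ennreal (G y) \<partial>lebesgue) < \<infinity>"
    using G by (simp add: nn_integral_eq_integral)
  have "emeasure lebesgue E \<le> ennreal (k ^ CARD('d) / (A * l)) * (\<integral>\<^sup>+y. ennreal (G y) \<partial>lebesgue)"
    unfolding E_def k_def by (rule weak_type) (use finG l in auto)
  also have "\<dots> < \<infinity>" using finG by (simp add: ennreal_mult_less_top)
  finally have finE: "emeasure lebesgue E < \<infinity>" .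
  have fm: "E \<in> fmeasurable lebesgue" "E \<inter> cube x r \<in> fmeasurable lebesgue" for x r
    using finE by (auto intro!: fmeasurableI fmeasurable_Int_fmeasurable)
  obtain B where B: "\<And>(c :: real ^ 'd) r. 0 < r \<Longrightarrow>
      ennreal \<delta> * emeasure lebesgue (cube c r) \<le> emeasure lebesgue E \<Longrightarrow> r \<le> B"
    using cube_diam_bounded[OF finE \<delta>(1), where 'd = 'd] by blast
  define P where "P x r \<longleftrightarrow> 0 < r \<and> \<delta> * measure lebesgue (cube x r) < measure lebesgue (E \<inter> cube x r)"
    for x r
  have PB: "r \<le> B" if "P x r" for x r
  proof (rule B)
    show r: "0 < r" using that by (simp add: P_def)
    have "\<delta> * measure lebesgue (cube x r) \<le> measure lebesgue E"
      using that measure_mono_fmeasurable[of "E \<inter> cube x r" E lebesgue] fm unfolding P_def by fastforce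
    then have "ennreal (\<delta> * measure lebesgue (cube x r)) \<le> emeasure lebesgue E"
      unfolding emeasure_eq_measure2[OF fm(1)] by (rule ennreal_leI)
    then show "ennreal \<delta> * emeasure lebesgue (cube x r) \<le> emeasure lebesgue E"
      unfolding emeasure_cube[OF r] measure_cube[OF r] using \<delta> r by (simp add: ennreal_mult)
  qed
  define I where "I = {(x, r). x \<in> E - N \<and> P x r \<and> \<not> P x (k * r)}"
  have ex: "\<exists>r. (x, r) \<in> I" if x: "x \<in> E - N" for x
  proof -
    obtain e where e: "0 < e" "cball x e \<subseteq> E"
      using x open_superlevel[of "\<lambda>y. ennreal (G y)" "A * l"]
      unfolding E_def[symmetric] open_contains_cball by blast
    have "E \<inter> cube x e = cube x e"
      using cube_subset_cball[of x e] e subset_cball[of "e / 2" e x] by auto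
    then have "P x e"
      unfolding P_def using e \<delta> measure_cube_pos[of e x] by simp
    \<comment> \<open>An admissible radius beyond half the supremum stops being admissible when it is doubled.\<close>
    define s where "s = Sup {r. P x r}"
    have bdd: "bdd_above {r. P x r}" using PB by (intro bdd_aboveI[of _ B]) auto
    have "0 < s" using cSup_upper[OF _ bdd, of e] \<open>P x e\<close> e by (simp add: s_def)
    then have "s / 2 < s" by simp
    then obtain r where r: "P x r" "s / 2 < r"
      using less_cSupE[of "s / 2" "{r. P x r}"] \<open>P x e\<close> unfolding s_def by blast
    have "\<not> P x (k * r)"
    proof
      assume "P x (k * r)"
      then have "k * r \<le> s" unfolding s_def using bdd by (intro cSup_upper) auto
      moreover have "2 * r \<le> k * r" using k r(1) unfolding P_def by (intro mult_right_mono) auto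
      ultimately show False using r(2) by simp
    qed
    with r x show ?thesis by (auto simp: I_def)
  qed
  have le: "emeasure lebesgue (E \<inter> (\<Union>(c, r)\<in>I. cube c r))
      \<le> ennreal (\<delta> * k ^ CARD('d)) * (\<integral>\<^sup>+y\<in>U. 1 \<partial>lebesgue)"
  proof (rule emeasure_cubes_le_of_dilates)
    show "0 < r \<and> r \<le> B" if "(c, r) \<in> I" for c r
      using that PB by (auto simp: I_def P_def)
    show "cube c r \<subseteq> U" if "(c, r) \<in> I" for c r
      using that key[of r c] unfolding I_def P_def U_def E_def N_def by blast
    show "emeasure lebesgue (E \<inter> cube c (vitali_factor TYPE('d) * r))
        \<le> ennreal (\<delta> * k ^ CARD('d)) * (\<integral>\<^sup>+y\<in>cube c r. 1 \<partial>lebesgue)" if cr: "(c, r) \<in> I" for c r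
    proof -
      have r: "0 < r" using cr by (auto simp: I_def P_def)
      have "measure lebesgue (E \<inter> cube c (k * r)) \<le> \<delta> * measure lebesgue (cube c (k * r))"
        using cr r k by (auto simp: I_def P_def)
      also have "\<dots> = \<delta> * k ^ CARD('d) * measure lebesgue (cube c r)"
        using measure_cube_dilate[OF r k(2), of c c] by simp
      finally have "emeasure lebesgue (E \<inter> cube c (k * r))
          \<le> ennreal (\<delta> * k ^ CARD('d) * measure lebesgue (cube c r))"
        unfolding emeasure_eq_measure2[OF fm(2)] by (rule ennreal_leI)
      also have "\<dots> = ennreal (\<delta> * k ^ CARD('d)) * emeasure lebesgue (cube c r)"
        unfolding emeasure_cube[OF r] measure_cube[OF r] using \<delta> k r by (simp add: ennreal_mult)
      finally show ?thesis by (simp add: k_def del: emeasure_completion)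
    qed
  qed auto
  have sub: "E - N \<subseteq> E \<inter> (\<Union>(c, r)\<in>I. cube c r)"
  proof
    fix x assume x: "x \<in> E - N"
    then obtain r where r: "(x, r) \<in> I" using ex by blast
    then have "x \<in> cube x r" by (intro center_in_cube) (auto simp: I_def P_def)
    with r x show "x \<in> E \<inter> (\<Union>(c, r)\<in>I. cube c r)" by blast
  qed
  have "emeasure lebesgue (E - N) \<le> emeasure lebesgue (E \<inter> (\<Union>(c, r)\<in>I. cube c r))"
    by (intro emeasure_mono[OF sub] sets.Int sets sets_open open_UN) (auto simp: open_cube)
  also note le
  also have "(\<integral>\<^sup>+y\<in>U. 1 \<partial>lebesgue) = emeasure lebesgue U"
    by simp
  finally have good: "emeasure lebesgue (E - N) \<le> ennreal (\<delta> * k ^ CARD('d)) * emeasure lebesgue U" .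
  have "emeasure lebesgue E \<le> emeasure lebesgue ((E - N) \<union> N)"
    by (rule emeasure_mono) auto
  also have "\<dots> \<le> emeasure lebesgue (E - N) + emeasure lebesgue N"
    by (rule emeasure_subadditive) auto
  also have "\<dots> \<le> ennreal (\<delta> * k ^ CARD('d)) * emeasure lebesgue U + emeasure lebesgue N"
    by (rule add_right_mono[OF good])
  finally show ?thesis by (simp only: E_def U_def N_def k_def)
qed

section \<open>Summation over a geometric sequence of levels\<close>

text \<open>
  The terms with \<open>l A^k < t\<close> form a geometric series that is dominated by its last term, hence by
  \<open>t powr \<sigma>\<close>; the constant does not depend on the starting level \<open>l\<close>.
\<close>

lemma geometric_sum_below:
  fixes A l t :: real
  assumes A: "1 < A" and \<sigma>: "0 < \<sigma>" and l: "0 < l"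
  shows "(\<Sum>k. ennreal ((l * A ^ k) powr \<sigma>) * indicator {y. l * A ^ k < y} t)
      \<le> ennreal (A powr \<sigma> / (A powr \<sigma> - 1) * t powr \<sigma>)"
proof -
  define c where "c = A powr \<sigma> / (A powr \<sigma> - 1)"
  have A\<sigma>: "1 < A powr \<sigma>" using A \<sigma> by simp
  have c: "0 < c" unfolding c_def using A\<sigma> by (intro divide_pos_pos) auto
  have c1: "c + A powr \<sigma> = c * A powr \<sigma>"
    using A\<sigma> by (simp add: c_def field_simps)
  have full: "(\<Sum>k\<le>n. (l * A ^ k) powr \<sigma>) \<le> c * (l * A ^ n) powr \<sigma>" for n
  proof (induction n)
    case 0
    have "1 \<le> c" using A\<sigma> by (simp add: c_def)
    then show ?case using mult_right_mono[of 1 c "l powr \<sigma>"] by simp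
  next
    case (Suc n)
    have "(l * A ^ Suc n) powr \<sigma> = A powr \<sigma> * (l * A ^ n) powr \<sigma>"
      using A l by (simp add: powr_mult mult_ac)
    then have "(\<Sum>k\<le>Suc n. (l * A ^ k) powr \<sigma>) \<le> (c + A powr \<sigma>) * (l * A ^ n) powr \<sigma>"
      using Suc by (simp add: distrib_right)
    also have "\<dots> = c * (l * A ^ Suc n) powr \<sigma>"
      using A l unfolding c1 by (simp add: powr_mult mult_ac)
    finally show ?case .
  qed
  have part: "(\<Sum>k<n. (l * A ^ k) powr \<sigma> * indicator {y. l * A ^ k < y} t) \<le> c * t powr \<sigma>" for n
  proof (induction n)
    case 0
    then show ?case using c by simp
  next
    case (Suc n)
    show ?case
    proof (cases "l * A ^ n < t")
      case True
      have "(\<Sum>k<Suc n. (l * A ^ k) powr \<sigma> * indicator {y. l * A ^ k < y} t)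
          \<le> (\<Sum>k\<le>n. (l * A ^ k) powr \<sigma>)"
        unfolding lessThan_Suc_atMost by (intro sum_mono) (auto simp: indicator_def)
      also have "\<dots> \<le> c * (l * A ^ n) powr \<sigma>" by (rule full)
      also have "\<dots> \<le> c * t powr \<sigma>"
        using True l A c \<sigma> by (intro mult_left_mono powr_mono2) auto
      finally show ?thesis .
    next
      case False
      then show ?thesis using Suc by simp
    qed
  qed
  show ?thesis
    unfolding c_def[symmetric]
  proof (rule suminf_le_const[OF summableI])
    fix n
    have "(\<Sum>k<n. ennreal ((l * A ^ k) powr \<sigma>) * indicator {y. l * A ^ k < y} t)
        = (\<Sum>k<n. ennreal ((l * A ^ k) powr \<sigma> * indicator {y. l * A ^ k < y} t))"
      by (intro sum.cong) (auto simp: indicator_def)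
    also have "\<dots> = ennreal (\<Sum>k<n. (l * A ^ k) powr \<sigma> * indicator {y. l * A ^ k < y} t)"
      by (intro sum_ennreal) auto
    also have "\<dots> \<le> ennreal (c * t powr \<sigma>)" by (intro ennreal_leI part)
    finally show "(\<Sum>k<n. ennreal ((l * A ^ k) powr \<sigma>) * indicator {y. l * A ^ k < y} t)
        \<le> ennreal (c * t powr \<sigma>)" .
  qed
qed

text \<open>
  Absorption of the term \<open>a k\<close>. The induction is on \<open>\<Sum>k<n. a k\<close> plus \<open>2 a n\<close>, so that nothing is
  subtracted and the sums may be infinite.
\<close>

lemma suminf_le_of_halving:
  fixes a b :: "nat \<Rightarrow> ennreal"
  assumes "\<And>k. 2 * a (Suc k) \<le> a k + 2 * b k"
  shows "(\<Sum>k. a k) \<le> 2 * a 0 + 2 * (\<Sum>k. b k)"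
proof (rule suminf_le_const[OF summableI])
  fix n
  have "(\<Sum>k<n. a k) + 2 * a n \<le> 2 * a 0 + 2 * (\<Sum>k<n. b k)"
  proof (induction n)
    case (Suc n)
    have "(\<Sum>k<Suc n. a k) + 2 * a (Suc n) \<le> (\<Sum>k<n. a k) + a n + (a n + 2 * b n)"
      using assms[of n] by (simp add: add_left_mono)
    also have "\<dots> = ((\<Sum>k<n. a k) + 2 * a n) + 2 * b n"
      by (simp add: mult_2 add_ac)
    also have "\<dots> \<le> (2 * a 0 + 2 * (\<Sum>k<n. b k)) + 2 * b n"
      by (rule add_right_mono[OF Suc])
    finally show ?case by (simp add: distrib_left add_ac)
  qed simp
  then have "(\<Sum>k<n. a k) \<le> 2 * a 0 + 2 * (\<Sum>k<n. b k)"
    by (rule order_trans[rotated]) simp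
  also have "\<dots> \<le> 2 * a 0 + 2 * (\<Sum>k. b k)"
    by (intro add_left_mono mult_left_mono sum_le_suminf) auto
  finally show "(\<Sum>k<n. a k) \<le> 2 * a 0 + 2 * (\<Sum>k. b k)" .
qed

text \<open>
  Levels \<open>l A^k\<close> replace the integral over all levels, so that only a countable sum is interchanged with an integral. Here \<open>a k\<close> and
  \<open>b k\<close> are \<open>(l A^k)^s |{M G > l A^k}|\<close> and \<open>(l A^(k+1))^s |{M F > \<gamma> l A^k}|\<close>. The condition on
  \<open>\<epsilon>\<close> is exactly what turns the good-lambda inequality into \<open>2 a (k+1) \<le> a k + 2 b k\<close>. The starting
  level \<open>l\<close> is positive to have a first term \<open>a 0\<close>, which leaves the error term in \<open>l powr (s - 1)\<close>.
\<close>

lemma strong_type_truncated: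
  fixes F G :: "real ^ 'd \<Rightarrow> real"
  assumes F: "integrable lebesgue F" "\<And>x. 0 \<le> F x"
    and G: "integrable lebesgue G" "\<And>x. 0 \<le> G x"
    and A: "1 < A" and s: "1 < s" and \<gamma>: "0 < \<gamma>" and \<epsilon>: "0 \<le> \<epsilon>" "2 * A powr s * \<epsilon> \<le> 1"
    and good: "\<And>l. 0 < l \<Longrightarrow>
      emeasure lebesgue (superlevel (\<lambda>y. ennreal (G y)) (A * l))
      \<le> ennreal \<epsilon> * emeasure lebesgue (superlevel (\<lambda>y. ennreal (G y)) l)
        + emeasure lebesgue (superlevel (\<lambda>y. ennreal (F y)) (\<gamma> * l))"
    and l: "0 < l"
  defines "c \<equiv> vitali_factor TYPE('d) ^ CARD('d)"
  defines "D \<equiv> A powr (s - 1) / (A powr (s - 1) - 1)"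
  shows "(\<integral>\<^sup>+x\<in>{x. l < G x}. ennreal (G x powr s) \<partial>lebesgue)
    \<le> ennreal (2 * A powr s * c * (LINT x|lebesgue. G x) * l powr (s - 1))
      + ennreal (2 * A powr s * (A powr s * c * D * (2 / \<gamma>) powr s)) *
        (\<integral>\<^sup>+x. ennreal (F x powr s) \<partial>lebesgue)"
proof -
  define e where "e k = emeasure lebesgue (superlevel (\<lambda>y. ennreal (G y)) (l * A ^ k))" for k
  define f where "f k = emeasure lebesgue (superlevel (\<lambda>y. ennreal (F y)) (\<gamma> * (l * A ^ k)))" for k
  define a where "a k = ennreal ((l * A ^ k) powr s) * e k" for k
  define b where "b k = ennreal (A powr s * (l * A ^ k) powr s) * f k" for k
  have [measurable]: "F \<in> borel_measurable lebesgue" "G \<in> borel_measurable lebesgue"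
    using F(1) G(1) by auto
  have c: "0 < c" using vitali_factor_ge[where 'd = 'd] by (simp add: c_def)
  have lk: "0 < l * A ^ k" for k using l A by simp
  have finF: "(\<integral>\<^sup>+y. ennreal (F y) \<partial>lebesgue) < \<infinity>"
    using F by (simp add: nn_integral_eq_integral)
  have finG: "(\<integral>\<^sup>+y. ennreal (G y) \<partial>lebesgue) < \<infinity>"
    using G by (simp add: nn_integral_eq_integral)
  have D: "0 < D"
    unfolding D_def using A s by (intro divide_pos_pos) auto
  have step: "(l * A ^ Suc k) powr s = A powr s * (l * A ^ k) powr s" for k
    using A l by (simp add: powr_mult mult_ac)

  \<comment> \<open>The good-lambda inequality at the level \<open>l A^k\<close>.\<close>
  have "2 * a (Suc k) \<le> a k + 2 * b k" for k
  proof -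
    have "2 * a (Suc k) = ennreal (2 * (A powr s * (l * A ^ k) powr s)) * e (Suc k)"
      unfolding a_def step by (simp add: ennreal_mult'' mult.assoc)
    also have "e (Suc k) \<le> ennreal \<epsilon> * e k + f k"
      using good[OF lk[of k]] by (simp add: e_def f_def mult_ac)
    also have "ennreal (2 * (A powr s * (l * A ^ k) powr s)) * (ennreal \<epsilon> * e k + f k)
        = ennreal (2 * (A powr s * (l * A ^ k) powr s) * \<epsilon>) * e k + 2 * b k"
      unfolding b_def using \<epsilon> by (simp add: distrib_left ennreal_mult'' ennreal_mult mult_ac)
    also have "ennreal (2 * (A powr s * (l * A ^ k) powr s) * \<epsilon>) \<le> ennreal ((l * A ^ k) powr s)"
      using mult_right_mono[OF \<epsilon>(2), of "(l * A ^ k) powr s"] by (intro ennreal_leI) (simp add: mult_ac)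
    finally show ?thesis by (simp add: a_def mult_left_mono mult_right_mono)
  qed
  then have sum_a: "(\<Sum>k. a k) \<le> 2 * a 0 + 2 * (\<Sum>k. b k)"
    by (rule suminf_le_of_halving)

  \<comment> \<open>The weak type bound for \<open>G\<close> at the lowest level.\<close>
  have a0: "a 0 \<le> ennreal (c * (LINT x|lebesgue. G x) * l powr (s - 1))"
  proof -
    have "e 0 \<le> ennreal (c / l) * (\<integral>\<^sup>+y. ennreal (G y) \<partial>lebesgue)"
      unfolding e_def c_def using l finG by (simp add: weak_type del: emeasure_completion)
    also have "(\<integral>\<^sup>+y. ennreal (G y) \<partial>lebesgue) = ennreal (LINT x|lebesgue. G x)"
      using G by (intro nn_integral_eq_integral) auto
    finally have "a 0 \<le> ennreal (l powr s) * (ennreal (c / l) * ennreal (LINT x|lebesgue. G x))"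
      unfolding a_def by (auto intro!: mult_left_mono)
    also have "\<dots> = ennreal (c * (LINT x|lebesgue. G x) * l powr (s - 1))"
      using l c G(2) by (simp add: ennreal_mult[symmetric] powr_diff field_simps)
    finally show ?thesis .
  qed

  \<comment> \<open>The maximal theorem for \<open>F\<close>: insert the truncated weak type bound and sum under the integral.\<close>
  have sum_b: "(\<Sum>k. b k) \<le> ennreal (A powr s * c * D * (2 / \<gamma>) powr s) * (\<integral>\<^sup>+x. ennreal (F x powr s) \<partial>lebesgue)"
  proof -
    let ?i = "\<lambda>k x. ennreal ((l * A ^ k) powr (s - 1)) * indicator {u. l * A ^ k < u} (2 / \<gamma> * F x)"
    have "b k \<le> ennreal (A powr s * c * (2 / \<gamma>)) * (\<integral>\<^sup>+x. ennreal (F x) * ?i k x \<partial>lebesgue)" for k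
    proof -
      let ?l = "l * A ^ k"
      have "f k \<le> ennreal (2 * c / (\<gamma> * ?l)) *
          (\<integral>\<^sup>+y\<in>{y. ennreal (\<gamma> * ?l / 2) < ennreal (F y)}. ennreal (F y) \<partial>lebesgue)"
        unfolding f_def c_def using \<gamma> lk[of k] finF
        by (intro weak_type_truncated) auto
      also have "(\<integral>\<^sup>+y\<in>{y. ennreal (\<gamma> * ?l / 2) < ennreal (F y)}. ennreal (F y) \<partial>lebesgue)
          = (\<integral>\<^sup>+x. ennreal (F x) * indicator {u. ?l < u} (2 / \<gamma> * F x) \<partial>lebesgue)"
      proof (intro nn_integral_cong)
        fix x
        have "ennreal (\<gamma> * ?l / 2) < ennreal (F x) \<longleftrightarrow> \<gamma> * ?l / 2 < F x"
          using \<gamma> lk[of k] by (simp add: ennreal_less_iff)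
        also have "\<dots> \<longleftrightarrow> ?l < 2 / \<gamma> * F x"
          using \<gamma> by (simp add: field_simps)
        finally show "ennreal (F x) * indicator {y. ennreal (\<gamma> * ?l / 2) < ennreal (F y)} x
            = ennreal (F x) * indicator {u. ?l < u} (2 / \<gamma> * F x)"
          by (simp add: indicator_def)
      qed
      finally have "b k \<le> ennreal (A powr s * ?l powr s) * (ennreal (2 * c / (\<gamma> * ?l)) *
          (\<integral>\<^sup>+x. ennreal (F x) * indicator {u. ?l < u} (2 / \<gamma> * F x) \<partial>lebesgue))"
        unfolding b_def by (rule mult_left_mono) simp
      also have "\<dots> = ennreal (A powr s * ?l powr s * (2 * c / (\<gamma> * ?l))) *
          (\<integral>\<^sup>+x. ennreal (F x) * indicator {u. ?l < u} (2 / \<gamma> * F x) \<partial>lebesgue)"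
        using c \<gamma> lk[of k] by (subst mult.assoc[symmetric], subst ennreal_mult[symmetric]) auto
      also have "A powr s * ?l powr s * (2 * c / (\<gamma> * ?l)) = A powr s * c * (2 / \<gamma>) * ?l powr (s - 1)"
        using lk[of k] \<gamma> by (simp add: powr_diff field_simps)
      also have "ennreal \<dots> * (\<integral>\<^sup>+x. ennreal (F x) * indicator {u. ?l < u} (2 / \<gamma> * F x) \<partial>lebesgue)
          = ennreal (A powr s * c * (2 / \<gamma>)) * (\<integral>\<^sup>+x. ennreal (F x) * ?i k x \<partial>lebesgue)"
      proof -
        have "(\<integral>\<^sup>+x. ennreal (F x) * ?i k x \<partial>lebesgue) = ennreal (?l powr (s - 1)) *
            (\<integral>\<^sup>+x. ennreal (F x) * indicator {u. ?l < u} (2 / \<gamma> * F x) \<partial>lebesgue)"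
          by (subst nn_integral_cmult[symmetric]) (auto intro!: nn_integral_cong simp: mult.left_commute)
        then show ?thesis
          using c \<gamma> by (subst ennreal_mult) (auto simp: mult.assoc)
      qed
      finally show ?thesis .
    qed
    then have "(\<Sum>k. b k) \<le> (\<Sum>k. ennreal (A powr s * c * (2 / \<gamma>)) * (\<integral>\<^sup>+x. ennreal (F x) * ?i k x \<partial>lebesgue))"
      by (intro suminf_le summableI)
    also have "\<dots> = ennreal (A powr s * c * (2 / \<gamma>)) * (\<integral>\<^sup>+x. (\<Sum>k. ennreal (F x) * ?i k x) \<partial>lebesgue)"
    proof -
      have "(\<integral>\<^sup>+x. (\<Sum>k. ennreal (F x) * ?i k x) \<partial>lebesgue)
          = (\<Sum>k. (\<integral>\<^sup>+x. ennreal (F x) * ?i k x \<partial>lebesgue))"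
        by (rule nn_integral_suminf) measurable
      then show ?thesis by (simp only: ennreal_suminf_cmult)
    qed
    also have "(\<integral>\<^sup>+x. (\<Sum>k. ennreal (F x) * ?i k x) \<partial>lebesgue)
        \<le> (\<integral>\<^sup>+x. ennreal (D * (2 / \<gamma>) powr (s - 1)) * ennreal (F x powr s) \<partial>lebesgue)"
    proof (intro nn_integral_mono)
      fix x
      have "(\<Sum>k. ennreal (F x) * ?i k x) = ennreal (F x) * (\<Sum>k. ?i k x)"
        by simp
      also have "\<dots> \<le> ennreal (F x) * ennreal (D * (2 / \<gamma> * F x) powr (s - 1))"
        unfolding D_def using A s l by (intro mult_left_mono geometric_sum_below) auto
      also have "\<dots> = ennreal (D * (2 / \<gamma>) powr (s - 1)) * ennreal (F x powr s)"
      proof -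
        have "F x * (2 / \<gamma> * F x) powr (s - 1) = (2 / \<gamma>) powr (s - 1) * (F x powr s)"
        proof (cases "F x = 0")
          case False
          then have "0 < F x" using F(2)[of x] by simp
          then have "F x * F x powr (s - 1) = F x powr s" by (simp add: powr_diff)
          moreover have "(2 / \<gamma> * F x) powr (s - 1) = (2 / \<gamma>) powr (s - 1) * F x powr (s - 1)"
            by (rule powr_mult)
          ultimately show ?thesis by (metis mult.left_commute)
        qed simp
        then show ?thesis
          using D F(2) by (simp add: ennreal_mult[symmetric] mult_ac)
      qed
      finally show "(\<Sum>k. ennreal (F x) * ?i k x)
          \<le> ennreal (D * (2 / \<gamma>) powr (s - 1)) * ennreal (F x powr s)" .
    qed
    also have "\<dots> = ennreal (D * (2 / \<gamma>) powr (s - 1)) * (\<integral>\<^sup>+x. ennreal (F x powr s) \<partial>lebesgue)"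
      by (intro nn_integral_cmult) simp
    also have "ennreal (A powr s * c * (2 / \<gamma>)) * \<dots>
        = ennreal (A powr s * c * D * (2 / \<gamma>) powr s) * (\<integral>\<^sup>+x. ennreal (F x powr s) \<partial>lebesgue)"
      using c D \<gamma> by (simp add: ennreal_mult[symmetric] mult.assoc[symmetric] powr_diff)
    finally show ?thesis by (simp add: mult_left_mono)
  qed

  have term_le: "t k \<le> (\<Sum>k. t k)" for t :: "nat \<Rightarrow> ennreal" and k
    using sum_le_suminf[of t "{k}"] by simp

  \<comment> \<open>If \<open>l A^k < G x \<le> l A^(k+1)\<close>, the \<open>k\<close>-th level set contains \<open>x\<close> and its term alone suffices.\<close>
  have "AE x in lebesgue. ennreal (G x powr s) * indicator {x. l < G x} x
      \<le> ennreal (A powr s) *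
        (\<Sum>k. ennreal ((l * A ^ k) powr s) * indicator (superlevel (\<lambda>y. ennreal (G y)) (l * A ^ k)) x)"
    using AE_le_off_superlevel[OF G]
  proof eventually_elim
    fix x
    assume x: "\<forall>t\<ge>0. t < G x \<longrightarrow> x \<in> superlevel (\<lambda>y. ennreal (G y)) t"
    let ?t = "\<lambda>k. ennreal ((l * A ^ k) powr s) * indicator (superlevel (\<lambda>y. ennreal (G y)) (l * A ^ k)) x"
    show "ennreal (G x powr s) * indicator {x. l < G x} x \<le> ennreal (A powr s) * (\<Sum>k. ?t k)"
    proof (cases "l < G x")
      case True
      obtain N where N: "G x / l < A ^ N" using real_arch_pow[OF A] by blast
      define M where "M = (LEAST n. G x \<le> l * A ^ n)"
      have exM: "G x \<le> l * A ^ N" using N l by (simp add: field_simps)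
      then have M: "G x \<le> l * A ^ M" unfolding M_def by (rule LeastI)
      then have "M \<noteq> 0" using True by (cases M) auto
      then obtain k where k: "M = Suc k" using not0_implies_Suc by blast
      then have "l * A ^ k < G x"
        using not_less_Least[of k "\<lambda>n. G x \<le> l * A ^ n"] unfolding M_def[symmetric] by auto
      then have mem: "x \<in> superlevel (\<lambda>y. ennreal (G y)) (l * A ^ k)" using x lk[of k] by auto
      have "ennreal (G x powr s) \<le> ennreal ((l * A ^ Suc k) powr s)"
        using M G(2) s unfolding k by (intro ennreal_leI powr_mono2) auto
      also have "\<dots> = ennreal (A powr s) * ?t k"
        unfolding step using mem by (simp add: ennreal_mult)
      also have "\<dots> \<le> ennreal (A powr s) * (\<Sum>k. ?t k)"
        by (intro mult_left_mono term_le) simp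
      finally show ?thesis using True by simp
    qed simp
  qed
  then have "(\<integral>\<^sup>+x\<in>{x. l < G x}. ennreal (G x powr s) \<partial>lebesgue)
      \<le> (\<integral>\<^sup>+x. ennreal (A powr s) *
        (\<Sum>k. ennreal ((l * A ^ k) powr s) * indicator (superlevel (\<lambda>y. ennreal (G y)) (l * A ^ k)) x) \<partial>lebesgue)"
    by (rule nn_integral_mono_AE)
  also have "\<dots> = ennreal (A powr s) * (\<Sum>k. a k)"
    by (simp add: nn_integral_cmult nn_integral_suminf a_def e_def nn_integral_cmult_indicator del: emeasure_completion)
  also have "\<dots> \<le> ennreal (A powr s) * (2 * ennreal (c * (LINT x|lebesgue. G x) * l powr (s - 1))
      + 2 * (ennreal (A powr s * c * D * (2 / \<gamma>) powr s) * (\<integral>\<^sup>+x. ennreal (F x powr s) \<partial>lebesgue)))"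
    by (intro mult_left_mono order_trans[OF sum_a] add_mono a0 sum_b) auto
  also have "\<dots> = ennreal (2 * A powr s * c * (LINT x|lebesgue. G x) * l powr (s - 1))
      + ennreal (2 * A powr s * (A powr s * c * D * (2 / \<gamma>) powr s)) *
        (\<integral>\<^sup>+x. ennreal (F x powr s) \<partial>lebesgue)"
    using c D G(2) by (simp add: distrib_left ennreal_mult mult_ac)
  finally show ?thesis .
qed

text \<open>
  Let the starting level of the truncated bound tend to 0 along \<open>1/(n+1)\<close>.
\<close>

lemma strong_type:
  fixes F G :: "real ^ 'd \<Rightarrow> real"
  assumes F: "integrable lebesgue F" "\<And>x. 0 \<le> F x"
    and G: "integrable lebesgue G" "\<And>x. 0 \<le> G x"
    and A: "1 < A" and s: "1 < s" and \<gamma>: "0 < \<gamma>" and \<epsilon>: "0 \<le> \<epsilon>" "2 * A powr s * \<epsilon> \<le> 1"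
    and good: "\<And>l. 0 < l \<Longrightarrow>
      emeasure lebesgue (superlevel (\<lambda>y. ennreal (G y)) (A * l))
      \<le> ennreal \<epsilon> * emeasure lebesgue (superlevel (\<lambda>y. ennreal (G y)) l)
        + emeasure lebesgue (superlevel (\<lambda>y. ennreal (F y)) (\<gamma> * l))"
  defines "c \<equiv> vitali_factor TYPE('d) ^ CARD('d)"
  defines "D \<equiv> A powr (s - 1) / (A powr (s - 1) - 1)"
  shows "(\<integral>\<^sup>+x. ennreal (G x powr s) \<partial>lebesgue)
    \<le> ennreal (2 * A powr s * (A powr s * c * D * (2 / \<gamma>) powr s)) *
        (\<integral>\<^sup>+x. ennreal (F x powr s) \<partial>lebesgue)"
proof -
  let ?W = "ennreal (2 * A powr s * (A powr s * c * D * (2 / \<gamma>) powr s)) *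
        (\<integral>\<^sup>+x. ennreal (F x powr s) \<partial>lebesgue)"
  define l :: "nat \<Rightarrow> real" where "l n = inverse (real (Suc n))" for n
  define u where "u n = (\<integral>\<^sup>+x\<in>{x. l n < G x}. ennreal (G x powr s) \<partial>lebesgue)" for n
  define v where "v n = 2 * A powr s * c * (LINT x|lebesgue. G x) * l n powr (s - 1)" for n
  have [measurable]: "G \<in> borel_measurable lebesgue" using G(1) by auto
  have l: "0 < l n" "l \<longlonglongrightarrow> 0" "n \<le> m \<Longrightarrow> l m \<le> l n" for n m
    unfolding l_def using LIMSEQ_inverse_real_of_nat by (auto simp: field_simps)
  have "(\<integral>\<^sup>+x. ennreal (G x powr s) \<partial>lebesgue)
      = (\<integral>\<^sup>+x. (SUP n. ennreal (G x powr s) * indicator {x. l n < G x} x) \<partial>lebesgue)"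
  proof (intro nn_integral_cong antisym)
    fix x
    show "ennreal (G x powr s) \<le> (SUP n. ennreal (G x powr s) * indicator {x. l n < G x} x)"
    proof (cases "G x = 0")
      case False
      then have "0 < G x" using G(2)[of x] by simp
      then obtain n where "l n < G x"
        using order_tendstoD(2)[OF l(2)] by (meson eventually_happens sequentially_bot)
      then have "ennreal (G x powr s) \<le> ennreal (G x powr s) * indicator {x. l n < G x} x" by simp
      then show ?thesis by (rule SUP_upper2[OF UNIV_I])
    qed (use s in simp)
    show "(SUP n. ennreal (G x powr s) * indicator {x. l n < G x} x) \<le> ennreal (G x powr s)"
      by (rule SUP_least) (auto simp: indicator_def)
  qed
  also have "\<dots> = (SUP n. u n)"
    unfolding u_def
  proof (rule nn_integral_monotone_convergence_SUP)
    show "incseq (\<lambda>n x. ennreal (G x powr s) * indicator {x. l n < G x} x)"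
      unfolding incseq_def le_fun_def
      by (auto simp: indicator_def intro: le_less_trans[OF l(3)])
  qed measurable
  finally have eq: "(\<integral>\<^sup>+x. ennreal (G x powr s) \<partial>lebesgue) = (SUP n. u n)" .
  have "incseq u"
    unfolding incseq_def u_def
    by (auto intro!: nn_integral_mono simp: indicator_def intro: le_less_trans[OF l(3)])
  then have lim: "u \<longlonglongrightarrow> (SUP n. u n)" by (rule LIMSEQ_SUP)
  have "(\<lambda>n. l n powr (s - 1)) \<longlonglongrightarrow> 0 powr (s - 1)"
    using s l(1) by (intro tendsto_powr' l(2) tendsto_const) (auto intro!: always_eventually less_imp_le)
  then have "v \<longlonglongrightarrow> 2 * A powr s * c * (LINT x|lebesgue. G x) * 0 powr (s - 1)"
    unfolding v_def by (rule tendsto_mult[OF tendsto_const])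
  then have "v \<longlonglongrightarrow> 0" by simp
  then have "(\<lambda>n. ennreal (v n) + ?W) \<longlonglongrightarrow> ennreal 0 + ?W"
    by (intro tendsto_add tendsto_const tendsto_ennrealI)
  moreover have "u n \<le> ennreal (v n) + ?W" for n
    unfolding u_def v_def c_def D_def
    by (rule strong_type_truncated[OF F G A s \<gamma> \<epsilon> good l(1)])
  ultimately have "(SUP n. u n) \<le> ennreal 0 + ?W"
    by (intro LIMSEQ_le[OF lim]) auto
  then show ?thesis unfolding eq by simp
qed

section \<open>The extrapolation theorem\<close>

text \<open>
  The choice of constants. Absorption requires \<open>\<delta> = 1 / (2 c A^s)\<close>, where \<open>c\<close> is the \<open>d\<close>-th power of the
  Vitali factor. The power \<open>A^(-q/2)\<close> in the local estimate is below half of this once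
  \<open>A^(q/2 - s) \<ge> X\<close>, which a large \<open>A\<close> satisfies because \<open>s < q/2\<close>. With \<open>A\<close> fixed, a small \<open>\<gamma>\<close> brings
  the contribution of \<open>F\<close> below the other half.
\<close>

lemma integral_powr_le_of_local_estimate:
  fixes b s q K :: real
  assumes s: "1 < s" "s < q / 2" and b: "1 < b" and K: "0 < K"
  shows "\<exists>C>0. \<forall>F G :: real ^ 'd \<Rightarrow> real.
    integrable lebesgue F \<longrightarrow> (\<forall>x. 0 \<le> F x) \<longrightarrow> integrable lebesgue G \<longrightarrow> (\<forall>x. 0 \<le> G x) \<longrightarrow>
    local_estimate K b q F G \<longrightarrow>
    (\<integral>\<^sup>+x. ennreal (G x powr s) \<partial>lebesgue)
      \<le> ennreal C * (\<integral>\<^sup>+x. ennreal (F x powr s) \<partial>lebesgue)"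
proof -
  define c where "c = vitali_factor TYPE('d) ^ CARD('d)"
  define L where "L = (4 * b) ^ CARD('d)"
  define X where "X = 4 * c * K * (2 * sqrt L) powr q"
  define A where "A = max (3 ^ CARD('d)) (X powr (1 / (q / 2 - s)))"
  define \<delta> where "\<delta> = 1 / (2 * c * A powr s)"
  define \<gamma> where "\<gamma> = min 1 (\<delta> * A / (2 * K * L))"
  define C where "C = 2 * A powr s * (A powr s * c * (A powr (s - 1) / (A powr (s - 1) - 1)) * (2 / \<gamma>) powr s)"
  have c: "1 \<le> c" unfolding c_def using vitali_factor_ge[where 'd = 'd] by (intro one_le_power) simp
  have L: "1 \<le> L" unfolding L_def using b by (intro one_le_power) simp
  have "(1 :: real) < 3 ^ CARD('d)" by (intro one_less_power) auto
  moreover have A3: "3 ^ CARD('d) \<le> A" by (simp add: A_def)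
  ultimately have A: "1 < A" "3 ^ CARD('d) \<le> A" by (rule less_le_trans, intro A3)
  have As: "1 \<le> A powr s" using A s by (intro ge_one_powr_ge_zero) auto
  have \<delta>: "0 < \<delta>" "\<delta> < 1"
  proof -
    have "1 \<le> c * A powr s" using c As by (rule mult_ge1_I)
    then show "0 < \<delta>" "\<delta> < 1" by (auto simp: \<delta>_def)
  qed
  have \<gamma>: "0 < \<gamma>" "\<gamma> \<le> 1" using \<delta> A K L by (auto simp: \<gamma>_def)
  have X: "0 < X" unfolding X_def using c K L by simp
  have "X = (X powr (1 / (q / 2 - s))) powr (q / 2 - s)"
    using X s by (simp add: powr_powr)
  also have "\<dots> \<le> A powr (q / 2 - s)"
    using s by (intro powr_mono2) (auto simp: A_def)
  finally have "X * A powr s \<le> A powr (q / 2)"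
    using A by (simp add: powr_diff pos_le_divide_eq)
  then have 1: "K * (2 * sqrt L) powr q / A powr (q / 2) \<le> \<delta> / 2"
    using A c by (simp add: X_def \<delta>_def field_simps)
  have "\<gamma> \<le> \<delta> * A / (2 * K * L)" by (simp add: \<gamma>_def)
  then have 2: "K * \<gamma> * L / A \<le> \<delta> / 2"
    using A K L by (simp add: field_simps)
  have const: "K * \<gamma> * (4 * b) ^ CARD('d) / A
      + K * (2 * sqrt ((4 * b) ^ CARD('d))) powr q / A powr (q / 2) \<le> \<delta>"
    unfolding L_def[symmetric] using 1 2 by linarith
  have "1 < A powr (s - 1)" using A s by simp
  then have C: "0 < C" unfolding C_def using A c \<gamma>
    by (intro mult_pos_pos divide_pos_pos) auto
  show ?thesis
  proof (intro exI[of _ C] conjI C allI impI)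
    fix F G :: "real ^ 'd \<Rightarrow> real"
    assume "integrable lebesgue F" "\<forall>x. 0 \<le> F x" "integrable lebesgue G" "\<forall>x. 0 \<le> G x"
      and est: "local_estimate K b q F G"
    then have F: "integrable lebesgue F" "\<And>x. 0 \<le> F x"
      and G: "integrable lebesgue G" "\<And>x. 0 \<le> G x" by auto
    show "(\<integral>\<^sup>+x. ennreal (G x powr s) \<partial>lebesgue) \<le> ennreal C * (\<integral>\<^sup>+x. ennreal (F x powr s) \<partial>lebesgue)"
      unfolding C_def c_def
    proof (rule strong_type[OF F G A(1) s(1) \<gamma>(1), of "\<delta> * c"])
      show "0 \<le> \<delta> * c" "2 * A powr s * (\<delta> * c) \<le> 1"
        using \<delta> c As by (auto simp: \<delta>_def)
      fix l :: real assume l: "0 < l"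
      show "emeasure lebesgue (superlevel (\<lambda>y. ennreal (G y)) (A * l))
        \<le> ennreal (\<delta> * c) * emeasure lebesgue (superlevel (\<lambda>y. ennreal (G y)) l)
          + emeasure lebesgue (superlevel (\<lambda>y. ennreal (F y)) (\<gamma> * l))"
        unfolding c_def
      proof (rule good_lambda[OF G _ \<delta>])
        show "0 < A * l" using A l by simp
        show "cube x r \<subseteq> superlevel (\<lambda>y. ennreal (G y)) l"
          if "0 < r" "x \<notin> superlevel (\<lambda>y. ennreal (F y)) (\<gamma> * l)"
            "\<delta> * measure lebesgue (cube x r)
              < measure lebesgue (superlevel (\<lambda>y. ennreal (G y)) (A * l) \<inter> cube x r)" for x r
          by (rule cube_subset_superlevel[OF F G b K _ \<gamma> A(2) l est const that]) (use s in simp)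
      qed
    qed
  qed
qed

lemma cnorm_nonneg: "0 \<le> cnorm k v"
  by (simp add: cnorm_def L2_set_nonneg)

lemma cnorm_power2_powr: "((cnorm k v)\<^sup>2) powr (p / 2) = cnorm k v powr p"
proof -
  have "(cnorm k v)\<^sup>2 = cnorm k v powr 2"
    using cnorm_nonneg by (simp add: powr_numeral)
  then show ?thesis by (simp add: powr_powr)
qed

lemma measurable_cnorm [measurable]:
  "cnorm k \<in> (\<Pi>\<^sub>M i\<in>{..<k}. borel) \<rightarrow>\<^sub>M borel"
  unfolding cnorm_def[abs_def] L2_set_def by measurable

lemma integrable_cnorm_power2:
  "f \<in> Lp_space k 2 \<Longrightarrow> integrable lebesgue (\<lambda>x. (cnorm k (f x))\<^sup>2)"
  using cnorm_nonneg by (simp add: Lp_space_def powr_numeral)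

theorem theorem5p2:
  fixes p q \<alpha>1 \<alpha>2 K :: real
  assumes "2 < p" and "p < q" and "1 < \<alpha>1" and "\<alpha>1 < \<alpha>2" and "0 < K"
  shows "\<exists>C>0. \<forall>(m::nat) (n::nat)
           (f :: real ^ 'd \<Rightarrow> nat \<Rightarrow> complex)
           (T :: (real ^ 'd \<Rightarrow> nat \<Rightarrow> complex) \<rightharpoonup> (real ^ 'd \<Rightarrow> nat \<Rightarrow> complex)) g.
           1 \<le> m \<longrightarrow> 1 \<le> n \<longrightarrow>
           f \<in> Lp_space m 2 \<inter> Lp_space m p \<longrightarrow>
           T f = Some g \<longrightarrow> g \<in> Lp_space n 2 \<longrightarrow>
           (\<forall>\<iota>>0. \<forall>x0 r x' r'. is_parent x' r' x0 r \<longrightarrow>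
              measure lebesgue
                {x \<in> cube x0 r.
                   local_maximal (cube x' (2 * r')) (\<lambda>y. (cnorm n (g y))\<^sup>2) x > ennreal \<iota>}
              \<le> K / \<iota> * (LINT x:cube x' (2 * \<alpha>2 * r')|lebesgue. (cnorm m (f x))\<^sup>2)
                + K * measure lebesgue (cube x0 r) / \<iota> powr (q / 2) *
                  (sqrt (1 / measure lebesgue (cube x0 r) *
                      (LINT x:cube x' (2 * \<alpha>2 * r')|lebesgue. (cnorm n (g x))\<^sup>2))
                   + (SUP Q \<in> {Q \<in> cubes. cube x' (2 * r') \<subseteq> Q}.
                       sqrt (1 / measure lebesgue Q *
                         (LINT x:Q|lebesgue. (cnorm m (f x))\<^sup>2)))) powr q) \<longrightarrow>
           g \<in> Lp_space n p \<and> Lp_norm n p g \<le> C * Lp_norm m p f"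
proof -
  have "1 < p / 2" "p / 2 < q / 2" "1 < \<alpha>2" using assms by auto
  from integral_powr_le_of_local_estimate[OF this \<open>0 < K\<close>, where 'd = 'd]
  obtain C where C: "0 < C" and bound: "\<And>F G :: real ^ 'd \<Rightarrow> real.
      integrable lebesgue F \<Longrightarrow> (\<And>x. 0 \<le> F x) \<Longrightarrow> integrable lebesgue G \<Longrightarrow> (\<And>x. 0 \<le> G x) \<Longrightarrow>
      local_estimate K \<alpha>2 q F G \<Longrightarrow>
      (\<integral>\<^sup>+x. ennreal (G x powr (p / 2)) \<partial>lebesgue)
        \<le> ennreal C * (\<integral>\<^sup>+x. ennreal (F x powr (p / 2)) \<partial>lebesgue)"
    by blast
  have goal: "g \<in> Lp_space n p \<and> Lp_norm n p g \<le> C powr (1 / p) * Lp_norm m p f"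
    if f: "f \<in> Lp_space m 2 \<inter> Lp_space m p" and g: "g \<in> Lp_space n 2"
      and est: "local_estimate K \<alpha>2 q (\<lambda>x. (cnorm m (f x))\<^sup>2) (\<lambda>x. (cnorm n (g x))\<^sup>2)"
    for m n and f g :: "real ^ 'd \<Rightarrow> nat \<Rightarrow> complex"
  proof -
    have [measurable]: "g \<in> lebesgue \<rightarrow>\<^sub>M (\<Pi>\<^sub>M i\<in>{..<n}. borel)"
      using g by (simp add: Lp_space_def)
    have fp: "integrable lebesgue (\<lambda>x. cnorm m (f x) powr p)"
      using f by (simp add: Lp_space_def)
    let ?If = "LINT x|lebesgue. cnorm m (f x) powr p"
    have If: "0 \<le> ?If" by (intro Bochner_Integration.integral_nonneg) simp
    have "(\<integral>\<^sup>+x. ennreal (((cnorm n (g x))\<^sup>2) powr (p / 2)) \<partial>lebesgue)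
        \<le> ennreal C * (\<integral>\<^sup>+x. ennreal (((cnorm m (f x))\<^sup>2) powr (p / 2)) \<partial>lebesgue)"
      using f g by (intro bound est integrable_cnorm_power2) auto
    then have le: "(\<integral>\<^sup>+x. ennreal (cnorm n (g x) powr p) \<partial>lebesgue)
        \<le> ennreal C * (\<integral>\<^sup>+x. ennreal (cnorm m (f x) powr p) \<partial>lebesgue)"
      by (simp only: cnorm_power2_powr)
    also have "\<dots> = ennreal (C * ?If)"
      using fp C If by (subst nn_integral_eq_integral) (auto simp: ennreal_mult)
    finally have le: "(\<integral>\<^sup>+x. ennreal (cnorm n (g x) powr p) \<partial>lebesgue) \<le> ennreal (C * ?If)" .
    have gp: "integrable lebesgue (\<lambda>x. cnorm n (g x) powr p)"
      by (rule integrableI_bounded) (use le in \<open>auto intro: le_less_trans\<close>)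
    have "ennreal (LINT x|lebesgue. cnorm n (g x) powr p) \<le> ennreal (C * ?If)"
      using le gp by (subst (asm) nn_integral_eq_integral) auto
    then have "(LINT x|lebesgue. cnorm n (g x) powr p) \<le> C * ?If"
      using C If by (simp add: ennreal_le_iff)
    then have "Lp_norm n p g \<le> (C * ?If) powr (1 / p)"
      unfolding Lp_norm_def using assms by (intro powr_mono2 Bochner_Integration.integral_nonneg) auto
    also have "\<dots> = C powr (1 / p) * Lp_norm m p f"
      unfolding Lp_norm_def using C If by (simp add: powr_mult)
    finally show ?thesis
      using gp by (simp add: Lp_space_def)
  qed
  show ?thesis
  proof (intro exI[of _ "C powr (1 / p)"] conjI allI impI, goal_cases)
    case 1
    show ?case using C by simp
  next
    case (2 m n f T g)
    have "local_estimate K \<alpha>2 q (\<lambda>x. (cnorm m (f x))\<^sup>2) (\<lambda>x. (cnorm n (g x))\<^sup>2)"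
      unfolding local_estimate_def by (rule 2(6))
    from goal[OF 2(3,5) this] show ?case by (rule conjunct1)
  next
    case (3 m n f T g)
    have "local_estimate K \<alpha>2 q (\<lambda>x. (cnorm m (f x))\<^sup>2) (\<lambda>x. (cnorm n (g x))\<^sup>2)"
      unfolding local_estimate_def by (rule 3(6))
    from goal[OF 3(3,5) this] show ?case by (rule conjunct2)
  qed
qed

end
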